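(* Let $G=(V,E,s,r)$ be a directed graph with no isolated vertices and in which every infinite receiver is an emitter (or equivalently, assume that the Cuntz--Krieger algebra $\mathcal{O}(G)$ is generated by $\mathcal{E}=\{S_e:e\in E\}$). Then $\mathcal{E}$ is not rigid at $0$ in $\mathcal{O}(G)$.
   Context: Directed graphs $G=(V,E,s,r)$ consist of countable sets $V$ (vertices) and $E$ (edges) and maps $s,r:E\to V$ (source and range); $v$ emits $e$ if $s(e)=v$ and receives $e$ if $r(e)=v$. A vertex is isolated if it emits no edges and receives no edges; it is an infinite receiver if $r^{-1}(v)$ is infinite; it is an emitter if $s^{-1}(v)\ne\emptyset$. A Cuntz--Krieger $G$-family consists of mutually orthogonal projections $\{P_v:v\in V\}$ and partial isometries $\{S_e:e\in E\}$ such that: (I) $S_e^*S_e=P_{s(e)}$ for all $e\in E$; (TCK) $\sum_{e\in F}S_eS_e^*\le P_v$ for every $v\in V$ and every finite $F\subset r^{-1}(v)$; (CK) $\sum_{r(e)=v}S_eS_e^*=P_v$ for every $v\in V$ with $0<|r^{-1}(v)|<\infty$. The Cuntz--Krieger algebra $\mathcal{O}(G)$ is the universal $C^*$-algebra generated by a Cuntz--Krieger $G$-family, and $P_v,S_e$ denote the generators of $\mathcal{O}(G)$. A generating subset $\mathcal{G}$ of a $C^*$-algebra $A$ is rigid at $0$ in $A$ if for every sequence of contractive positive maps $\varphi_n:A\to\mathbb{C}$: if $\lim_n\varphi_n(g)=0$ for all $g\in\mathcal{G}$, then $\lim_n\varphi_n(a)=0$ for all $a\in A$. *)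

theory Defs
  imports
    "HOL-Analysis.Analysis"
    "HOL-Algebra.Algebraic_Closure_Type"
    "Graph_Theory.Digraph"
begin

section \<open>C*-algebras\<close>

text \<open>
  C*-algebras are not assumed to be unital: the field \<open>one\<close> inherited from the ring record
  is never referred to. All other operations are only constrained on the carrier.
\<close>

record 'a cstar_alg = "(complex, 'a) module" +
  adj :: "'a \<Rightarrow> 'a"
  nrm :: "'a \<Rightarrow> real"

text \<open>
  The norm distance. It is set to \<open>0\<close> off the carrier because \<^locale>\<open>Metric_space\<close> demands
  symmetry and nonnegativity of its distance function on the whole type.
\<close>

definition cstar_dist :: "('a, 'm) cstar_alg_scheme \<Rightarrow> 'a \<Rightarrow> 'a \<Rightarrow> real" where
  "cstar_dist A x y = (if x \<in> carrier A \<and> y \<in> carrier A then nrm A (x \<ominus>\<^bsub>A\<^esub> y) else 0)"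

locale cstar_algebra = module "ring_of_type_algebra :: complex ring" A
  for A :: "('a, 'm) cstar_alg_scheme" (structure) +
  assumes mult_closed: "\<lbrakk>x \<in> carrier A; y \<in> carrier A\<rbrakk> \<Longrightarrow> x \<otimes> y \<in> carrier A"
    and mult_assoc: "\<lbrakk>x \<in> carrier A; y \<in> carrier A; z \<in> carrier A\<rbrakk>
      \<Longrightarrow> (x \<otimes> y) \<otimes> z = x \<otimes> (y \<otimes> z)"
    and distrib_right: "\<lbrakk>x \<in> carrier A; y \<in> carrier A; z \<in> carrier A\<rbrakk>
      \<Longrightarrow> (x \<oplus> y) \<otimes> z = x \<otimes> z \<oplus> y \<otimes> z"
    and distrib_left: "\<lbrakk>x \<in> carrier A; y \<in> carrier A; z \<in> carrier A\<rbrakk>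
      \<Longrightarrow> x \<otimes> (y \<oplus> z) = x \<otimes> y \<oplus> x \<otimes> z"
    and smult_mult_left: "\<lbrakk>x \<in> carrier A; y \<in> carrier A\<rbrakk>
      \<Longrightarrow> (c \<odot> x) \<otimes> y = c \<odot> (x \<otimes> y)"
    and smult_mult_right: "\<lbrakk>x \<in> carrier A; y \<in> carrier A\<rbrakk>
      \<Longrightarrow> x \<otimes> (c \<odot> y) = c \<odot> (x \<otimes> y)"
    and adj_closed: "x \<in> carrier A \<Longrightarrow> adj A x \<in> carrier A"
    and adj_adj: "x \<in> carrier A \<Longrightarrow> adj A (adj A x) = x"
    and adj_add: "\<lbrakk>x \<in> carrier A; y \<in> carrier A\<rbrakk> \<Longrightarrow> adj A (x \<oplus> y) = adj A x \<oplus> adj A y"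
    and adj_smult: "x \<in> carrier A \<Longrightarrow> adj A (c \<odot> x) = cnj c \<odot> adj A x"
    and adj_mult: "\<lbrakk>x \<in> carrier A; y \<in> carrier A\<rbrakk> \<Longrightarrow> adj A (x \<otimes> y) = adj A y \<otimes> adj A x"
    and nrm_nonneg: "x \<in> carrier A \<Longrightarrow> 0 \<le> nrm A x"
    and nrm_eq_zero_iff: "x \<in> carrier A \<Longrightarrow> nrm A x = 0 \<longleftrightarrow> x = \<zero>"
    and nrm_triangle: "\<lbrakk>x \<in> carrier A; y \<in> carrier A\<rbrakk> \<Longrightarrow> nrm A (x \<oplus> y) \<le> nrm A x + nrm A y"
    and nrm_smult: "x \<in> carrier A \<Longrightarrow> nrm A (c \<odot> x) = cmod c * nrm A x"
    and nrm_mult: "\<lbrakk>x \<in> carrier A; y \<in> carrier A\<rbrakk> \<Longrightarrow> nrm A (x \<otimes> y) \<le> nrm A x * nrm A y"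
    and cstar_identity: "x \<in> carrier A \<Longrightarrow> nrm A (adj A x \<otimes> x) = (nrm A x)\<^sup>2"
    and complete: "Metric_space.mcomplete (carrier A) (cstar_dist A)"

lemma (in cstar_algebra) Metric_space_cstar_dist: "Metric_space (carrier A) (cstar_dist A)"
proof
  have minus: "c \<ominus> b = (-1) \<odot> (b \<ominus> c)" if "b \<in> carrier A" "c \<in> carrier A" for b c
  proof -
    have neg: "(-1) \<odot> x = \<ominus> x" if x: "x \<in> carrier A" for x
    proof -
      have "x \<oplus> (-1) \<odot> x = (1 + (-1)) \<odot> x"
        using smult_l_distr[of 1 "-1" x] smult_one[OF x] x by (simp add: ring_of_type_algebra_def)
      also have "\<dots> = \<zero>"
        using nrm_smult[OF x, of 0] nrm_eq_zero_iff[of "0 \<odot> x"] smult_closed[of 0 x] x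
        by (simp add: ring_of_type_algebra_def)
      finally show ?thesis
        using x smult_closed[of "-1" x] M.minus_equality[of "(-1) \<odot> x" x] M.a_comm[of "(-1) \<odot> x" x]
        by (simp add: ring_of_type_algebra_def)
    qed
    show ?thesis using that neg[of "b \<ominus> c"]
      by (simp add: a_minus_def M.minus_add M.add.m_comm)
  qed
  fix x y z
  show "0 \<le> cstar_dist A x y"
    by (simp add: cstar_dist_def nrm_nonneg)
  show "cstar_dist A x y = cstar_dist A y x"
    using minus[of x y] nrm_smult[of "x \<ominus> y" "-1"] by (auto simp: cstar_dist_def)
  show "cstar_dist A x y = 0 \<longleftrightarrow> x = y" if "x \<in> carrier A" "y \<in> carrier A"
    using that M.minus_equality[of x "\<ominus> y"] M.r_neg[of y]
    by (auto simp: cstar_dist_def nrm_eq_zero_iff a_minus_def)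
  show "cstar_dist A x z \<le> cstar_dist A x y + cstar_dist A y z"
    if xyz: "x \<in> carrier A" "y \<in> carrier A" "z \<in> carrier A"
  proof -
    have "x \<ominus> z = (x \<ominus> y) \<oplus> (y \<ominus> z)"
      using xyz by (simp add: a_minus_def M.a_assoc M.r_neg1 M.r_neg2)
    then show ?thesis using xyz nrm_triangle[of "x \<ominus> y" "y \<ominus> z"] by (simp add: cstar_dist_def)
  qed
qed

definition star_subalgebra :: "('a, 'm) cstar_alg_scheme \<Rightarrow> 'a set \<Rightarrow> bool" where
  "star_subalgebra A B \<longleftrightarrow>
     B \<subseteq> carrier A \<and> \<zero>\<^bsub>A\<^esub> \<in> B \<and>
     (\<forall>x\<in>B. \<forall>y\<in>B. x \<oplus>\<^bsub>A\<^esub> y \<in> B \<and> x \<otimes>\<^bsub>A\<^esub> y \<in> B) \<and>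
     (\<forall>c. \<forall>x\<in>B. c \<odot>\<^bsub>A\<^esub> x \<in> B) \<and> (\<forall>x\<in>B. adj A x \<in> B)"

text \<open>\<open>U\<close> generates \<open>A\<close> as a C*-algebra (without adjoining a unit).\<close>

definition generates :: "('a, 'm) cstar_alg_scheme \<Rightarrow> 'a set \<Rightarrow> bool" where
  "generates A U \<longleftrightarrow> U \<subseteq> carrier A \<and>
     (\<forall>B. star_subalgebra A B \<and>
          closedin (Metric_space.mtopology (carrier A) (cstar_dist A)) B \<and> U \<subseteq> B
        \<longrightarrow> B = carrier A)"

definition star_hom :: "('a, 'm) cstar_alg_scheme \<Rightarrow> ('b, 'n) cstar_alg_scheme \<Rightarrow> ('a \<Rightarrow> 'b) set"
  where "star_hom A B = {\<pi>.
     (\<forall>x\<in>carrier A. \<pi> x \<in> carrier B) \<and>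
     (\<forall>x\<in>carrier A. \<forall>y\<in>carrier A. \<pi> (x \<oplus>\<^bsub>A\<^esub> y) = \<pi> x \<oplus>\<^bsub>B\<^esub> \<pi> y) \<and>
     (\<forall>x\<in>carrier A. \<forall>y\<in>carrier A. \<pi> (x \<otimes>\<^bsub>A\<^esub> y) = \<pi> x \<otimes>\<^bsub>B\<^esub> \<pi> y) \<and>
     (\<forall>c. \<forall>x\<in>carrier A. \<pi> (c \<odot>\<^bsub>A\<^esub> x) = c \<odot>\<^bsub>B\<^esub> \<pi> x) \<and>
     (\<forall>x\<in>carrier A. \<pi> (adj A x) = adj B (\<pi> x))}"

definition cstar_positive :: "('a, 'm) cstar_alg_scheme \<Rightarrow> 'a \<Rightarrow> bool" where
  "cstar_positive A a \<longleftrightarrow> (\<exists>b\<in>carrier A. a = adj A b \<otimes>\<^bsub>A\<^esub> b)"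

definition cstar_le :: "('a, 'm) cstar_alg_scheme \<Rightarrow> 'a \<Rightarrow> 'a \<Rightarrow> bool" where
  "cstar_le A x y \<longleftrightarrow> cstar_positive A (y \<ominus>\<^bsub>A\<^esub> x)"

definition projection :: "('a, 'm) cstar_alg_scheme \<Rightarrow> 'a \<Rightarrow> bool" where
  "projection A p \<longleftrightarrow> p \<in> carrier A \<and> adj A p = p \<and> p \<otimes>\<^bsub>A\<^esub> p = p"

definition partial_isometry :: "('a, 'm) cstar_alg_scheme \<Rightarrow> 'a \<Rightarrow> bool" where
  "partial_isometry A s \<longleftrightarrow> s \<in> carrier A \<and> s \<otimes>\<^bsub>A\<^esub> adj A s \<otimes>\<^bsub>A\<^esub> s = s"


section \<open>Contractive positive functionals and rigidity at zero\<close>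

definition linear_functional :: "('a, 'm) cstar_alg_scheme \<Rightarrow> ('a \<Rightarrow> complex) \<Rightarrow> bool" where
  "linear_functional A \<phi> \<longleftrightarrow>
     (\<forall>x\<in>carrier A. \<forall>y\<in>carrier A. \<phi> (x \<oplus>\<^bsub>A\<^esub> y) = \<phi> x + \<phi> y) \<and>
     (\<forall>c. \<forall>x\<in>carrier A. \<phi> (c \<odot>\<^bsub>A\<^esub> x) = c * \<phi> x)"

definition contractive_positive :: "('a, 'm) cstar_alg_scheme \<Rightarrow> ('a \<Rightarrow> complex) \<Rightarrow> bool" where
  "contractive_positive A \<phi> \<longleftrightarrow>
     linear_functional A \<phi> \<and>
     (\<forall>x\<in>carrier A. cmod (\<phi> x) \<le> nrm A x) \<and>
     (\<forall>x\<in>carrier A. cstar_positive A x \<longrightarrow> \<phi> x \<in> \<real>\<^sub>\<ge>\<^sub>0)"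

definition rigid_at_zero :: "('a, 'm) cstar_alg_scheme \<Rightarrow> 'a set \<Rightarrow> bool" where
  "rigid_at_zero A U \<longleftrightarrow>
     (\<forall>\<phi> :: nat \<Rightarrow> 'a \<Rightarrow> complex.
        (\<forall>n. contractive_positive A (\<phi> n)) \<and> (\<forall>g\<in>U. (\<lambda>n. \<phi> n g) \<longlonglongrightarrow> 0)
        \<longrightarrow> (\<forall>a\<in>carrier A. (\<lambda>n. \<phi> n a) \<longlonglongrightarrow> 0))"


section \<open>Directed graphs and their Cuntz--Krieger algebras\<close>

text \<open>
  The source map is \<^const>\<open>tail\<close> and the range map is \<^const>\<open>head\<close>, so the edges received by
  \<open>v\<close> are \<open>in_arcs G v\<close> and those emitted by \<open>v\<close> are \<open>out_arcs G v\<close>. Loops and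
  parallel edges are allowed.
\<close>

definition isolated :: "('v, 'e) pre_digraph \<Rightarrow> 'v \<Rightarrow> bool" where
  "isolated G v \<longleftrightarrow> out_arcs G v = {} \<and> in_arcs G v = {}"

definition infinite_receiver :: "('v, 'e) pre_digraph \<Rightarrow> 'v \<Rightarrow> bool" where
  "infinite_receiver G v \<longleftrightarrow> infinite (in_arcs G v)"

definition emitter :: "('v, 'e) pre_digraph \<Rightarrow> 'v \<Rightarrow> bool" where
  "emitter G v \<longleftrightarrow> out_arcs G v \<noteq> {}"

definition ck_family ::
  "('v, 'e) pre_digraph \<Rightarrow> ('a, 'm) cstar_alg_scheme \<Rightarrow> ('v \<Rightarrow> 'a) \<Rightarrow> ('e \<Rightarrow> 'a) \<Rightarrow> bool" where
  "ck_family G A P S \<longleftrightarrow>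
     (\<forall>v\<in>verts G. projection A (P v)) \<and>
     (\<forall>v\<in>verts G. \<forall>w\<in>verts G. v \<noteq> w \<longrightarrow> P v \<otimes>\<^bsub>A\<^esub> P w = \<zero>\<^bsub>A\<^esub>) \<and>
     (\<forall>e\<in>arcs G. partial_isometry A (S e)) \<and>
     (\<forall>e\<in>arcs G. adj A (S e) \<otimes>\<^bsub>A\<^esub> S e = P (tail G e)) \<and>
     (\<forall>v\<in>verts G. \<forall>F. finite F \<and> F \<subseteq> in_arcs G v \<longrightarrow>
        cstar_le A (\<Oplus>\<^bsub>A\<^esub>e\<in>F. S e \<otimes>\<^bsub>A\<^esub> adj A (S e)) (P v)) \<and>
     (\<forall>v\<in>verts G. in_arcs G v \<noteq> {} \<and> finite (in_arcs G v) \<longrightarrow>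
        (\<Oplus>\<^bsub>A\<^esub>e\<in>in_arcs G v. S e \<otimes>\<^bsub>A\<^esub> adj A (S e)) = P v)"

text \<open>
  \<open>A\<close>, with the generators \<open>P\<close> and \<open>S\<close>, is the universal C*-algebra generated by a
  Cuntz--Krieger \<open>G\<close>-family. HOL cannot quantify over all types inside a formula, so the
  universal property ranges over the C*-algebras \<open>B\<close> whose carrier is an arbitrary subset of
  the type \<open>nat \<Rightarrow> complex\<close>. For countable \<open>G\<close> this is no restriction: a family in
  any C*-algebra lies in the C*-subalgebra it generates, which is separable, hence has at most
  continuum many elements and is isomorphic to one with its carrier in this type. Uniqueness of
  the homomorphism follows from generation.
\<close>

definition is_ck_algebra ::
  "('v, 'e) pre_digraph \<Rightarrow> 'a cstar_alg \<Rightarrow> ('v \<Rightarrow> 'a) \<Rightarrow> ('e \<Rightarrow> 'a) \<Rightarrow> bool" where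
  "is_ck_algebra G A P S \<longleftrightarrow>
     cstar_algebra A \<and> ck_family G A P S \<and>
     generates A (P ` verts G \<union> S ` arcs G) \<and>
     (\<forall>(B :: (nat \<Rightarrow> complex) cstar_alg) Q T. cstar_algebra B \<and> ck_family G B Q T \<longrightarrow>
        (\<exists>\<pi>\<in>star_hom A B. (\<forall>v\<in>verts G. \<pi> (P v) = Q v) \<and> (\<forall>e\<in>arcs G. \<pi> (S e) = T e)))"

end

theory Submission
  imports Defs
begin

text \<open>
  The two conditions on the graph say that each vertex emits an edge, or receives at least one
  and only finitely many. In the first case a vertex projection is \<open>P v = S e* S e\<close> for
  an edge \<open>e\<close> that \<open>v\<close> emits; in the second it is the finite sum of the
  \<open>S e S e*\<close> over the edges that \<open>v\<close> receives. So the edges generate everything.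
  Conversely, if \<open>v\<close> emits nothing and receives no edge or infinitely many, then no relation
  links \<open>P v\<close> to the edges: sending \<open>P v\<close> to the identity and all other generators to
  \<open>0\<close> is a Cuntz--Krieger family. The kernel of the induced homomorphism is a C*-subalgebra
  that contains the edges but not \<open>P v\<close>.

  Rigidity fails because the Cuntz--Krieger relations do not see the sign of the edges. Take a
  family \<open>(Q, T)\<close> of operators with \<open>Q v\<close> nonzero, and let
  \<open>\<pi>\<close> and \<open>\<rho>\<close> be the homomorphisms induced by \<open>(Q, T)\<close> and
  \<open>(Q, -T)\<close>. If \<open>\<psi>\<close> is a vector state, the average of
  \<open>\<psi> o \<pi>\<close> and \<open>\<psi> o \<rho>\<close> is a contractive positive functional that
  vanishes on all edges, and equals \<open>1\<close> on \<open>P v\<close> if the vector lies in the range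
  of \<open>Q v\<close>. The constant sequence of this functional refutes rigidity. In other
  words, a state is averaged over the elements \<open>1\<close> and \<open>-1\<close> of the circle
  that acts on the algebra by gauge automorphisms.

  Two things have to be supplied. The first is a C*-algebra that contains such a family: the
  bounded operators on a separable Hilbert space (\<open>cstar_algebra_op_algebra\<close>), where
  partial bijections between sets of basis vectors give the partial isometries
  (\<open>ck_family_op_algebra_exists\<close>). Its operators are determined by their matrix entries,
  which moves it into the type \<open>nat \<Rightarrow> complex\<close> over which the universal
  property ranges (\<open>ck_algebra_universal\<close>). The second is that homomorphisms into this
  algebra are contractive (\<open>star_hom_contractive\<close>), which rests on the existence of
  square roots of \<open>1 - a\<close> for self-adjoint \<open>a\<close> of norm less than \<open>1\<close>
  (\<open>quasi_square_root\<close>).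
\<close>

section \<open>The Hilbert space of square-summable sequences\<close>

typedef ell2 = "{x :: nat \<Rightarrow> complex. (\<lambda>k. (cmod (x k))\<^sup>2) summable_on UNIV}"
  morphisms coord Abs_ell2
  by (rule exI[of _ "\<lambda>_. 0"]) simp

setup_lifting type_definition_ell2

lemma square_summable_inner:
  fixes x y :: "'i \<Rightarrow> complex"
  assumes "(\<lambda>k. (cmod (x k))\<^sup>2) summable_on A" and "(\<lambda>k. (cmod (y k))\<^sup>2) summable_on A"
  shows "(\<lambda>k. inner (x k) (y k)) summable_on A"
proof (rule abs_summable_summable, rule Infinite_Sum.abs_summable_on_comparison_test)
  show "(\<lambda>k. norm ((cmod (x k))\<^sup>2 + (cmod (y k))\<^sup>2)) summable_on A"
    using summable_on_add[OF assms] by simp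
  show "norm (inner (x k) (y k)) \<le> norm ((cmod (x k))\<^sup>2 + (cmod (y k))\<^sup>2)" for k
  proof -
    have "\<bar>inner (x k) (y k)\<bar> \<le> cmod (x k) * cmod (y k)"
      by (rule Cauchy_Schwarz_ineq2)
    also have "\<dots> \<le> (cmod (x k))\<^sup>2 + (cmod (y k))\<^sup>2"
    proof -
      have "0 \<le> (cmod (x k) - cmod (y k))\<^sup>2 + (cmod (x k))\<^sup>2 + (cmod (y k))\<^sup>2" by simp
      then show ?thesis by (simp add: power2_eq_square algebra_simps)
    qed
    finally show ?thesis by simp
  qed
qed

lemma square_summable_add:
  fixes x y :: "'i \<Rightarrow> complex"
  assumes "(\<lambda>k. (cmod (x k))\<^sup>2) summable_on A" and "(\<lambda>k. (cmod (y k))\<^sup>2) summable_on A"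
  shows "(\<lambda>k. (cmod (x k + y k))\<^sup>2) summable_on A"
proof -
  have "(\<lambda>k. (cmod (x k))\<^sup>2 + (cmod (y k))\<^sup>2 + 2 * inner (x k) (y k)) summable_on A"
    by (intro summable_on_add summable_on_cmult_right square_summable_inner assms)
  then show ?thesis
    by (simp add: power2_norm_eq_inner inner_add_left inner_add_right inner_commute algebra_simps)
qed

lemma square_summable_scale:
  fixes x :: "'i \<Rightarrow> complex"
  assumes "(\<lambda>k. (cmod (x k))\<^sup>2) summable_on A"
  shows "(\<lambda>k. (cmod (c * x k))\<^sup>2) summable_on A"
  using summable_on_cmult_right[OF assms, of "(cmod c)\<^sup>2"] by (simp add: norm_mult power_mult_distrib)

lift_definition cscale :: "complex \<Rightarrow> ell2 \<Rightarrow> ell2" is "\<lambda>c x k. c * x k"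
  by (rule square_summable_scale)

lift_definition basis :: "nat \<Rightarrow> ell2" is "\<lambda>j k. if k = j then 1 else 0"
proof -
  fix j :: nat
  have "(\<lambda>k. (cmod (if k = j then 1 else 0))\<^sup>2) summable_on {j}" by simp
  then show "(\<lambda>k. (cmod (if k = j then 1 else 0))\<^sup>2) summable_on UNIV"
    by (subst summable_on_cong_neutral[where T = "{j}" and g = "\<lambda>k. (cmod (if k = j then 1 else 0))\<^sup>2"]) auto
qed

instantiation ell2 :: real_vector
begin
lift_definition zero_ell2 :: ell2 is "\<lambda>_. 0" by simp
lift_definition plus_ell2 :: "ell2 \<Rightarrow> ell2 \<Rightarrow> ell2" is "\<lambda>x y k. x k + y k"
  by (rule square_summable_add)
lift_definition uminus_ell2 :: "ell2 \<Rightarrow> ell2" is "\<lambda>x k. - x k" by simp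
lift_definition minus_ell2 :: "ell2 \<Rightarrow> ell2 \<Rightarrow> ell2" is "\<lambda>x y k. x k - y k"
  using square_summable_add[where y = "\<lambda>k. - y k" for y] by fastforce
lift_definition scaleR_ell2 :: "real \<Rightarrow> ell2 \<Rightarrow> ell2" is "\<lambda>r x k. complex_of_real r * x k"
  by (rule square_summable_scale)
instance
  by standard (transfer; simp add: algebra_simps fun_eq_iff)+
end

instantiation ell2 :: real_inner
begin
definition inner_ell2 :: "ell2 \<Rightarrow> ell2 \<Rightarrow> real" where
  "inner_ell2 x y = (\<Sum>\<^sub>\<infinity>k. inner (coord x k) (coord y k))"
definition norm_ell2 :: "ell2 \<Rightarrow> real" where "norm_ell2 x = sqrt (inner x x)"
definition sgn_ell2 :: "ell2 \<Rightarrow> ell2" where "sgn_ell2 x = x /\<^sub>R norm x"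
definition dist_ell2 :: "ell2 \<Rightarrow> ell2 \<Rightarrow> real" where "dist_ell2 x y = norm (x - y)"
definition uniformity_ell2 :: "(ell2 \<times> ell2) filter" where
  "uniformity_ell2 = (INF e\<in>{0<..}. principal {(x, y). dist x y < e})"
definition open_ell2 :: "ell2 set \<Rightarrow> bool" where
  "open_ell2 U = (\<forall>x\<in>U. \<forall>\<^sub>F (x', y) in uniformity. x' = x \<longrightarrow> y \<in> U)"

instance
proof
  fix x y z :: ell2 and r :: real
  have sq: "(\<lambda>k. (cmod (coord u k))\<^sup>2) summable_on UNIV" for u
    using coord[of u] by simp
  have summ: "(\<lambda>k. inner (coord u k) (coord v k)) summable_on UNIV" for u v
    by (intro square_summable_inner sq)
  show "inner x y = inner y x" by (simp add: inner_ell2_def inner_commute)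
  show "inner (x + y) z = inner x z + inner y z"
    by (simp add: inner_ell2_def plus_ell2.rep_eq inner_add_left infsum_add[OF summ summ])
  show "inner (r *\<^sub>R x) y = r * inner x y"
    unfolding inner_ell2_def scaleR_ell2.rep_eq infsum_cmult_right'[symmetric]
    by (simp add: inner_complex_def algebra_simps)
  show nonneg: "0 \<le> inner x x"
    unfolding inner_ell2_def by (rule infsum_nonneg) simp
  show "inner x x = 0 \<longleftrightarrow> x = 0"
  proof
    assume z: "inner x x = 0"
    have "inner (coord x k) (coord x k) = 0" for k
      by (rule nonneg_infsum_le_0D[OF _ summ]) (use z in \<open>simp_all add: inner_ell2_def\<close>)
    then show "x = 0" by (simp add: zero_ell2.rep_eq fun_eq_iff flip: coord_inject)
  qed (simp add: inner_ell2_def zero_ell2.rep_eq)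
qed (simp_all add: norm_ell2_def sgn_ell2_def dist_ell2_def uniformity_ell2_def open_ell2_def)
end

lemma square_summable_coord: "(\<lambda>k. (cmod (coord x k))\<^sup>2) summable_on UNIV"
  using coord[of x] by simp

lemma norm_ell2_square: "(norm x)\<^sup>2 = (\<Sum>\<^sub>\<infinity>k. (cmod (coord x k))\<^sup>2)" for x :: ell2
  by (simp add: power2_norm_eq_inner inner_ell2_def)

lemma ell2_eqI: "(\<And>k. coord x k = coord y k) \<Longrightarrow> x = y"
  by (simp add: fun_eq_iff flip: coord_inject)

lemma sum_coord_le: "finite F \<Longrightarrow> (\<Sum>k\<in>F. (cmod (coord x k))\<^sup>2) \<le> (norm x)\<^sup>2" for x :: ell2
  unfolding norm_ell2_square by (rule finite_sum_le_infsum[OF square_summable_coord]) auto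

lemma norm_coord_le: "cmod (coord x k) \<le> norm x" for x :: ell2
  using sum_coord_le[of "{k}" x] by (simp add: power2_le_iff_abs_le)

text \<open>
  A Cauchy sequence converges in each coordinate, because coordinates are contractive. A bound on the
  norms of the differences bounds all finite partial sums, hence survives the passage to the limit.
\<close>

instance ell2 :: banach
proof
  fix f :: "nat \<Rightarrow> ell2"
  assume fCauchy: "Cauchy f"
  have "Cauchy (\<lambda>n. coord (f n) k)" for k
  proof (rule metric_CauchyI)
    fix e :: real assume "0 < e"
    then obtain N where N: "\<And>m n. m \<ge> N \<Longrightarrow> n \<ge> N \<Longrightarrow> norm (f m - f n) < e"
      using fCauchy unfolding Cauchy_def dist_norm by blast
    show "\<exists>N. \<forall>m\<ge>N. \<forall>n\<ge>N. dist (coord (f m) k) (coord (f n) k) < e"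
    proof (intro exI allI impI)
      fix m n assume "N \<le> m" "N \<le> n"
      then show "dist (coord (f m) k) (coord (f n) k) < e"
        using N[of m n] norm_coord_le[of "f m - f n" k] by (simp add: dist_norm minus_ell2.rep_eq)
    qed
  qed
  then have "\<forall>k. \<exists>l. (\<lambda>n. coord (f n) k) \<longlonglongrightarrow> l"
    by (simp add: Cauchy_convergent_iff convergent_def)
  then obtain L where L: "\<And>k. (\<lambda>n. coord (f n) k) \<longlonglongrightarrow> L k" by metis
  have tail: "(\<Sum>k\<in>F. (cmod (coord (f n) k - L k))\<^sup>2) \<le> e\<^sup>2"
    if N: "\<And>m n. m \<ge> N \<Longrightarrow> n \<ge> N \<Longrightarrow> norm (f m - f n) < e" and "n \<ge> N" and "finite F" for e N n F
  proof (rule LIMSEQ_le_const2)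
    show "(\<lambda>m. \<Sum>k\<in>F. (cmod (coord (f n) k - coord (f m) k))\<^sup>2)
        \<longlonglongrightarrow> (\<Sum>k\<in>F. (cmod (coord (f n) k - L k))\<^sup>2)"
      by (intro tendsto_intros L)
    show "\<exists>M. \<forall>m\<ge>M. (\<Sum>k\<in>F. (cmod (coord (f n) k - coord (f m) k))\<^sup>2) \<le> e\<^sup>2"
    proof (intro exI allI impI)
      fix m assume "m \<ge> N"
      have "(\<Sum>k\<in>F. (cmod (coord (f n - f m) k))\<^sup>2) \<le> (norm (f n - f m))\<^sup>2"
        by (rule sum_coord_le[OF \<open>finite F\<close>])
      also have "\<dots> \<le> e\<^sup>2"
        using N[OF \<open>n \<ge> N\<close> \<open>m \<ge> N\<close>] by (intro power_mono) auto
      finally show "(\<Sum>k\<in>F. (cmod (coord (f n) k - coord (f m) k))\<^sup>2) \<le> e\<^sup>2"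
        by (simp add: minus_ell2.rep_eq)
    qed
  qed
  have diff: "(\<lambda>k. (cmod (coord (f n) k - L k))\<^sup>2) summable_on UNIV"
    if N: "\<And>m n. m \<ge> N \<Longrightarrow> n \<ge> N \<Longrightarrow> norm (f m - f n) < e" and "n \<ge> N" for e N n
    by (rule nonneg_bdd_above_summable_on) (auto intro!: bdd_aboveI2 tail that)
  have fC: "\<exists>N. \<forall>m\<ge>N. \<forall>n\<ge>N. norm (f m - f n) < e" if "0 < e" for e
    using fCauchy that unfolding Cauchy_def dist_norm by blast
  obtain N1 where N1: "\<And>m n. m \<ge> N1 \<Longrightarrow> n \<ge> N1 \<Longrightarrow> norm (f m - f n) < 1"
    using fC[of 1] by auto
  define x where "x = f N1 - Abs_ell2 (\<lambda>k. coord (f N1) k - L k)"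
  have x: "coord x k = L k" for k
    using diff[OF N1 order_refl] by (simp add: x_def minus_ell2.rep_eq Abs_ell2_inverse)
  have "f \<longlonglongrightarrow> x"
  proof (rule metric_LIMSEQ_I)
    fix r :: real assume "0 < r"
    then obtain N where N: "\<And>m n. m \<ge> N \<Longrightarrow> n \<ge> N \<Longrightarrow> norm (f m - f n) < r / 2"
      using fC[of "r / 2"] by auto
    have "dist (f n) x < r" if "n \<ge> N" for n
    proof -
      have "(norm (f n - x))\<^sup>2 \<le> (r / 2)\<^sup>2"
        unfolding norm_ell2_square minus_ell2.rep_eq x
        by (rule infsum_le_finite_sums[OF diff[OF N that]]) (auto intro!: tail N that)
      then have "norm (f n - x) \<le> r / 2"
        using \<open>0 < r\<close> by (simp add: power2_le_iff_abs_le)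
      then show ?thesis using \<open>0 < r\<close> by (simp add: dist_norm)
    qed
    then show "\<exists>N. \<forall>n\<ge>N. dist (f n) x < r" by blast
  qed
  then show "convergent f" by (auto simp: convergent_def)
qed

lemma coord_simps [simp]:
  "coord (x + y) k = coord x k + coord y k"
  "coord (x - y) k = coord x k - coord y k"
  "coord (- x) k = - coord x k"
  "coord 0 k = 0"
  "coord (cscale c x) k = c * coord x k"
  "coord (basis j) k = (if k = j then 1 else 0)"
  by (simp_all add: plus_ell2.rep_eq minus_ell2.rep_eq uminus_ell2.rep_eq zero_ell2.rep_eq
      cscale.rep_eq basis.rep_eq)

lemma coord_scaleR: "coord (r *\<^sub>R x) k = complex_of_real r * coord x k"
  by (simp add: scaleR_ell2.rep_eq)

lemma cscale_simps [simp]: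
  "cscale c (x + y) = cscale c x + cscale c y"
  "cscale c (x - y) = cscale c x - cscale c y"
  "cscale c 0 = 0"
  "cscale 1 x = x"
  "cscale c (cscale d x) = cscale (c * d) x"
  by (rule ell2_eqI; simp add: algebra_simps)+

lemma cscale_of_real: "cscale (complex_of_real r) x = r *\<^sub>R x"
  by (rule ell2_eqI) (simp add: scaleR_ell2.rep_eq)

lemma inner_cscale_left: "inner (cscale c x) y = inner x (cscale (cnj c) y)"
  by (simp add: inner_ell2_def inner_complex_def algebra_simps)

lemma norm_cscale: "norm (cscale c x) = cmod c * norm x"
proof -
  have "(norm (cscale c x))\<^sup>2 = (cmod c * norm x)\<^sup>2"
    by (simp add: norm_ell2_square norm_mult power_mult_distrib infsum_cmult_right')
  then show ?thesis by (simp add: power2_eq_iff_nonneg)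
qed

text \<open>
  The inner product is the real part of the usual sesquilinear one. Pairing with a basis vector and
  with its multiple by \<open>\<i>\<close> recovers both parts of a coordinate.
\<close>

lemma inner_basis:
  "inner x (basis j) = Re (coord x j)"
  "inner x (cscale \<i> (basis j)) = Im (coord x j)"
proof -
  have "inner x (cscale c (basis j)) = inner (coord x j) c" for c
  proof -
    have "inner x (cscale c (basis j)) = (\<Sum>\<^sub>\<infinity>k\<in>{j}. inner (coord x k) c)"
      unfolding inner_ell2_def by (rule infsum_cong_neutral) auto
    then show ?thesis by simp
  qed
  from this[of 1] this[of \<i>] show "inner x (basis j) = Re (coord x j)"
    "inner x (cscale \<i> (basis j)) = Im (coord x j)"
    by (simp_all add: inner_complex_def)
qed

lemma norm_basis [simp]: "norm (basis j) = 1"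
  by (simp add: norm_eq_sqrt_inner inner_basis)

definition scalar_op :: "complex \<Rightarrow> ell2 \<Rightarrow>\<^sub>L ell2" where
  "scalar_op c = Blinfun (cscale c)"

lemma scalar_op_apply [simp]: "blinfun_apply (scalar_op c) x = cscale c x"
proof -
  have "bounded_linear (cscale c)"
  proof (rule bounded_linear_intro)
    show "cscale c (r *\<^sub>R x) = r *\<^sub>R cscale c x" for r x
      by (simp add: mult.commute flip: cscale_of_real)
    show "norm (cscale c x) \<le> norm x * cmod c" for x
      by (simp add: norm_cscale)
  qed simp
  then show ?thesis by (simp add: scalar_op_def bounded_linear_Blinfun_apply)
qed

section \<open>The C*-algebra of bounded operators\<close>

text \<open>
  Adjoints are taken for the real inner product. Between complex-linear operators they agree with the
  adjoints for the sesquilinear one, since scalar multiplication by \<open>c\<close> has the adjoint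
  \<open>cnj c\<close>.
\<close>

definition is_adjoint :: "(ell2 \<Rightarrow>\<^sub>L ell2) \<Rightarrow> (ell2 \<Rightarrow>\<^sub>L ell2) \<Rightarrow> bool" where
  "is_adjoint T T' \<longleftrightarrow> (\<forall>x y. inner (T x) y = inner x (T' y))"

definition op_adjoint :: "(ell2 \<Rightarrow>\<^sub>L ell2) \<Rightarrow> ell2 \<Rightarrow>\<^sub>L ell2" where
  "op_adjoint T = (THE T'. is_adjoint T T')"

text \<open>
  Having an adjoint is part of the definition, which spares an appeal to the Riesz representation
  theorem; by that theorem these are all bounded complex-linear operators.
\<close>

definition adjointable_ops :: "(ell2 \<Rightarrow>\<^sub>L ell2) set" where
  "adjointable_ops = {T. (\<exists>T'. is_adjoint T T') \<and> (\<forall>c x. T (cscale c x) = cscale c (T x))}"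

definition op_algebra :: "(ell2 \<Rightarrow>\<^sub>L ell2) cstar_alg" where
  "op_algebra = \<lparr>carrier = adjointable_ops, monoid.mult = (o\<^sub>L), one = id_blinfun,
     ring.zero = 0, ring.add = (+), module.smult = (\<lambda>c T. scalar_op c o\<^sub>L T),
     cstar_alg.adj = op_adjoint, cstar_alg.nrm = norm\<rparr>"

lemma op_algebra_simps [simp]:
  "carrier op_algebra = adjointable_ops"
  "T \<otimes>\<^bsub>op_algebra\<^esub> U = T o\<^sub>L U"
  "\<zero>\<^bsub>op_algebra\<^esub> = 0"
  "T \<oplus>\<^bsub>op_algebra\<^esub> U = T + U"
  "c \<odot>\<^bsub>op_algebra\<^esub> T = scalar_op c o\<^sub>L T"
  "adj op_algebra = op_adjoint"
  "nrm op_algebra = norm"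
  by (simp_all add: op_algebra_def)

lemma is_adjoint_unique: "is_adjoint T U \<Longrightarrow> is_adjoint T V \<Longrightarrow> U = V"
  unfolding is_adjoint_def by (intro blinfun_eqI) (metis vector_eq_ldot)

lemma adjoint_eqI: "is_adjoint T U \<Longrightarrow> op_adjoint T = U"
  unfolding op_adjoint_def by (blast intro: is_adjoint_unique the_equality)

lemma is_adjoint_sym: "is_adjoint T U \<Longrightarrow> is_adjoint U T"
  unfolding is_adjoint_def by (metis inner_commute)

lemma is_adjoint_compose: "is_adjoint T T' \<Longrightarrow> is_adjoint U U' \<Longrightarrow> is_adjoint (T o\<^sub>L U) (U' o\<^sub>L T')"
  by (simp add: is_adjoint_def)

lemma is_adjoint_add: "is_adjoint T T' \<Longrightarrow> is_adjoint U U' \<Longrightarrow> is_adjoint (T + U) (T' + U')"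
  by (simp add: is_adjoint_def blinfun.add_left inner_add_left inner_add_right)

lemma is_adjoint_minus: "is_adjoint T T' \<Longrightarrow> is_adjoint (- T) (- T')"
  by (simp add: is_adjoint_def blinfun.minus_left)

lemma is_adjoint_zero: "is_adjoint 0 0"
  by (simp add: is_adjoint_def)

lemma is_adjoint_scalar: "is_adjoint (scalar_op c) (scalar_op (cnj c))"
  by (simp add: is_adjoint_def inner_cscale_left)

lemma is_adjoint_op_adjoint: "T \<in> adjointable_ops \<Longrightarrow> is_adjoint T (op_adjoint T)"
  unfolding adjointable_ops_def using adjoint_eqI by blast

lemma adjointable_opsI:
  "is_adjoint T T' \<Longrightarrow> (\<And>c x. T (cscale c x) = cscale c (T x)) \<Longrightarrow> T \<in> adjointable_ops"
  by (auto simp: adjointable_ops_def)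

lemma op_cscale: "T \<in> adjointable_ops \<Longrightarrow> T (cscale c x) = cscale c (T x)"
  by (simp add: adjointable_ops_def)

lemma scalar_op_commute: "T \<in> adjointable_ops \<Longrightarrow> T o\<^sub>L scalar_op c = scalar_op c o\<^sub>L T"
  by (rule blinfun_eqI) (simp add: op_cscale)

lemma norm_adjoint_le: "is_adjoint T T' \<Longrightarrow> norm T' \<le> norm T"
proof (rule norm_blinfun_bound)
  assume T: "is_adjoint T T'"
  fix y
  have "norm (T' y) * norm (T' y) = inner (T (T' y)) y"
    using T by (simp add: is_adjoint_def power2_norm_eq_inner flip: power2_eq_square)
  also have "\<dots> \<le> norm (T (T' y)) * norm y" by (rule norm_cauchy_schwarz)
  also have "\<dots> \<le> norm T * norm (T' y) * norm y"
    by (intro mult_right_mono norm_blinfun) simp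
  finally have "norm (T' y) * norm (T' y) \<le> norm (T' y) * (norm T * norm y)"
    by (simp add: mult_ac)
  then show "norm (T' y) \<le> norm T * norm y"
    by (cases "norm (T' y) = 0") (auto simp: mult_le_cancel_left)
qed simp

text \<open>
  The C*-identity. The lower bound on the left-hand side is
  \<open>\<parallel>T x\<parallel>\<^sup>2 = \<langle>T* T x, x\<rangle>\<close>.
\<close>

lemma norm_adjoint_compose: 
  assumes T: "is_adjoint T T'" shows "norm (T' o\<^sub>L T) = (norm T)\<^sup>2"
proof (rule antisym)
  have "norm (T' o\<^sub>L T) \<le> norm T' * norm T" by (rule norm_blinfun_compose)
  also have "\<dots> \<le> norm T * norm T" by (intro mult_right_mono norm_adjoint_le T) simp
  finally show "norm (T' o\<^sub>L T) \<le> (norm T)\<^sup>2" by (simp add: power2_eq_square)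
  have "norm T \<le> sqrt (norm (T' o\<^sub>L T))"
  proof (rule norm_blinfun_bound)
    fix x
    have "(norm (T x))\<^sup>2 = inner ((T' o\<^sub>L T) x) x"
      using T by (simp add: is_adjoint_def power2_norm_eq_inner inner_commute)
    also have "\<dots> \<le> norm ((T' o\<^sub>L T) x) * norm x" by (rule norm_cauchy_schwarz)
    also have "\<dots> \<le> norm (T' o\<^sub>L T) * norm x * norm x"
      by (intro mult_right_mono norm_blinfun) simp
    finally have "(norm (T x))\<^sup>2 \<le> (sqrt (norm (T' o\<^sub>L T)) * norm x)\<^sup>2"
      by (simp add: power_mult_distrib power2_eq_square[of "norm x"] mult.assoc)
    then show "norm (T x) \<le> sqrt (norm (T' o\<^sub>L T)) * norm x"
      by (rule power2_le_imp_le) simp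
  qed simp
  from power_mono[OF this, of 2] show "(norm T)\<^sup>2 \<le> norm (T' o\<^sub>L T)" by simp
qed

lemma norm_scalar_op_compose: "norm (scalar_op c o\<^sub>L T) = cmod c * norm T"
proof -
  have le: "norm (scalar_op d o\<^sub>L U) \<le> cmod d * norm U" for d U
  proof (rule norm_blinfun_bound)
    show "norm ((scalar_op d o\<^sub>L U) x) \<le> cmod d * norm U * norm x" for x
      using mult_left_mono[OF norm_blinfun[of U x], of "cmod d"] by (simp add: norm_cscale mult.assoc)
  qed simp
  show ?thesis
  proof (cases "c = 0")
    case False
    have "norm T = norm (scalar_op (inverse c) o\<^sub>L (scalar_op c o\<^sub>L T))"
      using False by (intro arg_cong[of _ _ norm] blinfun_eqI) simp
    also have "\<dots> \<le> inverse (cmod c) * norm (scalar_op c o\<^sub>L T)"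
      using le[of "inverse c"] by (simp add: norm_inverse)
    finally have "cmod c * norm T \<le> norm (scalar_op c o\<^sub>L T)"
      using False by (simp add: field_simps)
    with le[of c T] show ?thesis by simp
  qed (use le[of 0 T] in simp)
qed

lemma adjointable_ops_binary:
  assumes T: "T \<in> adjointable_ops" and U: "U \<in> adjointable_ops"
  shows "T + U \<in> adjointable_ops" "T o\<^sub>L U \<in> adjointable_ops"
proof -
  note adj = is_adjoint_op_adjoint[OF T] is_adjoint_op_adjoint[OF U]
  show "T + U \<in> adjointable_ops"
    by (rule adjointable_opsI[OF is_adjoint_add[OF adj]]) (simp add: blinfun.add_left op_cscale assms)
  show "T o\<^sub>L U \<in> adjointable_ops"
    by (rule adjointable_opsI[OF is_adjoint_compose[OF adj]]) (simp add: op_cscale assms)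
qed

lemma adjointable_ops_unary:
  assumes T: "T \<in> adjointable_ops"
  shows "- T \<in> adjointable_ops" "scalar_op c o\<^sub>L T \<in> adjointable_ops" "op_adjoint T \<in> adjointable_ops"
proof -
  note adj = is_adjoint_op_adjoint[OF T]
  show "- T \<in> adjointable_ops"
  proof (rule adjointable_opsI[OF is_adjoint_minus[OF adj]])
    show "(- T) (cscale c x) = cscale c ((- T) x)" for c x
      using cscale_simps(2)[of c 0] by (simp add: blinfun.minus_left op_cscale T)
  qed
  show "scalar_op c o\<^sub>L T \<in> adjointable_ops"
    by (rule adjointable_opsI[OF is_adjoint_compose[OF is_adjoint_scalar adj]])
      (simp add: op_cscale T mult.commute)
  show "op_adjoint T \<in> adjointable_ops"
  proof (rule adjointable_opsI[OF is_adjoint_sym[OF adj]])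
    fix c y
    have "inner x (op_adjoint T (cscale c y)) = inner x (cscale c (op_adjoint T y))" for x
    proof -
      have "inner x (op_adjoint T (cscale c y)) = inner (T x) (cscale (cnj (cnj c)) y)"
        using adj by (simp add: is_adjoint_def)
      also have "\<dots> = inner (T (cscale (cnj c) x)) y"
        by (simp only: op_cscale[OF T] inner_cscale_left)
      also have "\<dots> = inner (cscale (cnj c) x) (op_adjoint T y)"
        using adj by (simp add: is_adjoint_def)
      also have "\<dots> = inner x (cscale c (op_adjoint T y))"
        by (simp add: inner_cscale_left)
      finally show ?thesis .
    qed
    then show "op_adjoint T (cscale c y) = cscale c (op_adjoint T y)"
      by (metis vector_eq_ldot)
  qed
qed

lemmas adjointable_ops_closed = adjointable_ops_binary adjointable_ops_unary

lemma zero_adjointable: "0 \<in> adjointable_ops"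
  by (rule adjointable_opsI[OF is_adjoint_zero]) simp

lemma abelian_group_op_algebra: "abelian_group op_algebra"
proof (rule abelian_groupI)
  show "\<exists>y\<in>carrier op_algebra. y \<oplus>\<^bsub>op_algebra\<^esub> x = \<zero>\<^bsub>op_algebra\<^esub>" if "x \<in> carrier op_algebra" for x
    using that by (intro bexI[of _ "- x"]) (auto intro: adjointable_ops_closed)
qed (auto simp: zero_adjointable adjointable_ops_closed add_ac)

lemma module_op_algebra: "Module.module (ring_of_type_algebra :: complex ring) op_algebra"
proof (rule moduleI[OF _ abelian_group_op_algebra])
  show "cring (ring_of_type_algebra :: complex ring)" by (rule cring_from_type_algebra)
qed (auto simp: ring_of_type_algebra_def adjointable_ops_closed blinfun.add_left blinfun.add_right
    intro!: blinfun_eqI, auto intro!: ell2_eqI simp: algebra_simps)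

lemma op_algebra_minus:
  assumes "T \<in> adjointable_ops" "U \<in> adjointable_ops"
  shows "T \<ominus>\<^bsub>op_algebra\<^esub> U = T - U"
proof -
  interpret abelian_group op_algebra by (rule abelian_group_op_algebra)
  have "\<ominus>\<^bsub>op_algebra\<^esub> U = - U"
    using assms by (intro minus_equality) (auto simp: adjointable_ops_closed)
  then show ?thesis by (simp add: a_minus_def)
qed

lemma op_algebra_finsum:
  assumes "finite F" "\<And>i. i \<in> F \<Longrightarrow> T i \<in> adjointable_ops"
  shows "finsum op_algebra T F = sum T F"
proof -
  interpret abelian_group op_algebra by (rule abelian_group_op_algebra)
  show ?thesis
    using assms by (induction F rule: finite_induct) (simp_all add: Pi_def)
qed

lemma op_algebra_dist:
  "T \<in> adjointable_ops \<Longrightarrow> U \<in> adjointable_ops \<Longrightarrow> cstar_dist op_algebra T U = norm (T - U)"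
  by (simp add: cstar_dist_def op_algebra_minus)

lemma op_algebra_Metric_space: "Metric_space adjointable_ops (cstar_dist op_algebra)"
proof
  show "cstar_dist op_algebra x y = cstar_dist op_algebra y x" for x y
    by (cases "x \<in> adjointable_ops \<and> y \<in> adjointable_ops")
      (auto simp: op_algebra_dist norm_minus_commute, auto simp: cstar_dist_def)
  show "0 \<le> cstar_dist op_algebra x y" for x y
    by (simp add: cstar_dist_def)
qed (auto simp: op_algebra_dist intro: norm_triangle_sub order_trans[OF norm_triangle_ineq4]
      dist_triangle simp flip: dist_norm)

text \<open>
  Since taking adjoints is isometric, the adjoints of a Cauchy sequence of operators are Cauchy too,
  and the limits of the two sequences are adjoint to each other.
\<close>

lemma complete_op_algebra: "Metric_space.mcomplete adjointable_ops (cstar_dist op_algebra)"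
proof -
  interpret Metric_space adjointable_ops "cstar_dist op_algebra" by (rule op_algebra_Metric_space)
  show ?thesis unfolding mcomplete_def
  proof (intro allI impI)
    fix \<sigma> assume "MCauchy \<sigma>"
    then have \<sigma>: "\<sigma> n \<in> adjointable_ops" for n by (auto simp: MCauchy_def)
    have Cauchy: "\<forall>e>0. \<exists>N. \<forall>m\<ge>N. \<forall>n\<ge>N. norm (\<sigma> m - \<sigma> n) < e"
      using \<open>MCauchy \<sigma>\<close> \<sigma> by (auto simp: MCauchy_def op_algebra_dist)
    have adjs: "is_adjoint (\<sigma> n) (op_adjoint (\<sigma> n))" for n by (rule is_adjoint_op_adjoint[OF \<sigma>])
    have "norm (op_adjoint (\<sigma> m) - op_adjoint (\<sigma> n)) \<le> norm (\<sigma> m - \<sigma> n)" for m n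
      using norm_adjoint_le[OF is_adjoint_add[OF adjs[of m] is_adjoint_minus[OF adjs[of n]]]] by simp
    then have "\<forall>e>0. \<exists>N. \<forall>m\<ge>N. \<forall>n\<ge>N. norm (op_adjoint (\<sigma> m) - op_adjoint (\<sigma> n)) < e"
      using Cauchy by (meson order_le_less_trans)
    then have "Cauchy \<sigma>" "Cauchy (\<lambda>n. op_adjoint (\<sigma> n))"
      using Cauchy by (auto simp: Cauchy_def dist_norm)
    then obtain T T' where T: "\<sigma> \<longlonglongrightarrow> T" and T': "(\<lambda>n. op_adjoint (\<sigma> n)) \<longlonglongrightarrow> T'"
      by (auto simp: Cauchy_convergent_iff convergent_def)
    have "inner (T x) y = inner x (T' y)" for x y
    proof (rule LIMSEQ_unique)
      show "(\<lambda>n. inner (\<sigma> n x) y) \<longlonglongrightarrow> inner (T x) y"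
        by (intro tendsto_intros T)
      show "(\<lambda>n. inner (\<sigma> n x) y) \<longlonglongrightarrow> inner x (T' y)"
        using adjs unfolding is_adjoint_def by (auto intro!: tendsto_intros T')
    qed
    then have "is_adjoint T T'" by (simp add: is_adjoint_def)
    moreover have "T (cscale c x) = cscale c (T x)" for c x
    proof (rule LIMSEQ_unique)
      show "(\<lambda>n. \<sigma> n (cscale c x)) \<longlonglongrightarrow> T (cscale c x)"
        by (intro tendsto_intros T)
      have "(\<lambda>n. scalar_op c (\<sigma> n x)) \<longlonglongrightarrow> scalar_op c (T x)"
        by (intro tendsto_intros T)
      then show "(\<lambda>n. \<sigma> n (cscale c x)) \<longlonglongrightarrow> cscale c (T x)"
        by (simp add: op_cscale \<sigma>)
    qed
    ultimately have T_in: "T \<in> adjointable_ops" by (rule adjointable_opsI)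
    have "limitin mtopology \<sigma> T sequentially"
      using T T_in \<sigma> by (simp add: limit_metric_sequentially op_algebra_dist LIMSEQ_iff)
    then show "\<exists>x. limitin mtopology \<sigma> x sequentially" by blast
  qed
qed

lemma cstar_algebra_op_algebra: "cstar_algebra op_algebra"
proof (intro cstar_algebra.intro module_op_algebra cstar_algebra_axioms.intro)
  fix T U V c
  show "Metric_space.mcomplete (carrier op_algebra) (cstar_dist op_algebra)"
    using complete_op_algebra by simp
  assume T: "T \<in> carrier op_algebra"
  note adjT = is_adjoint_op_adjoint[of T]
  show "adj op_algebra T \<in> carrier op_algebra"
    using T by (simp add: adjointable_ops_closed)
  show "adj op_algebra (adj op_algebra T) = T"
    using T by (simp add: adjoint_eqI is_adjoint_sym adjT)
  show "adj op_algebra (c \<odot>\<^bsub>op_algebra\<^esub> T) = cnj c \<odot>\<^bsub>op_algebra\<^esub> adj op_algebra T"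
    using T adjoint_eqI[OF is_adjoint_compose[OF is_adjoint_scalar adjT], of c]
    by (simp add: scalar_op_commute adjointable_ops_closed)
  show "0 \<le> nrm op_algebra T" "nrm op_algebra T = 0 \<longleftrightarrow> T = \<zero>\<^bsub>op_algebra\<^esub>" by simp_all
  show "nrm op_algebra (c \<odot>\<^bsub>op_algebra\<^esub> T) = cmod c * nrm op_algebra T"
    by (simp add: norm_scalar_op_compose)
  show "nrm op_algebra (adj op_algebra T \<otimes>\<^bsub>op_algebra\<^esub> T) = (nrm op_algebra T)\<^sup>2"
    using T by (simp add: norm_adjoint_compose adjT)
  assume U: "U \<in> carrier op_algebra"
  note adjU = is_adjoint_op_adjoint[of U]
  show "T \<otimes>\<^bsub>op_algebra\<^esub> U \<in> carrier op_algebra" using T U by (simp add: adjointable_ops_closed)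
  show "(c \<odot>\<^bsub>op_algebra\<^esub> T) \<otimes>\<^bsub>op_algebra\<^esub> U = c \<odot>\<^bsub>op_algebra\<^esub> (T \<otimes>\<^bsub>op_algebra\<^esub> U)"
    by (auto intro!: blinfun_eqI)
  show "T \<otimes>\<^bsub>op_algebra\<^esub> (c \<odot>\<^bsub>op_algebra\<^esub> U) = c \<odot>\<^bsub>op_algebra\<^esub> (T \<otimes>\<^bsub>op_algebra\<^esub> U)"
    using T by (auto intro!: blinfun_eqI simp: op_cscale)
  show "adj op_algebra (T \<oplus>\<^bsub>op_algebra\<^esub> U) = adj op_algebra T \<oplus>\<^bsub>op_algebra\<^esub> adj op_algebra U"
    using T U by (simp add: adjoint_eqI is_adjoint_add adjT adjU)
  show "adj op_algebra (T \<otimes>\<^bsub>op_algebra\<^esub> U) = adj op_algebra U \<otimes>\<^bsub>op_algebra\<^esub> adj op_algebra T"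
    using T U by (simp add: adjoint_eqI is_adjoint_compose adjT adjU)
  show "nrm op_algebra (T \<oplus>\<^bsub>op_algebra\<^esub> U) \<le> nrm op_algebra T + nrm op_algebra U"
    by (simp add: norm_triangle_ineq)
  show "nrm op_algebra (T \<otimes>\<^bsub>op_algebra\<^esub> U) \<le> nrm op_algebra T * nrm op_algebra U"
    by (simp add: norm_blinfun_compose)
  show "(T \<otimes>\<^bsub>op_algebra\<^esub> U) \<otimes>\<^bsub>op_algebra\<^esub> V = T \<otimes>\<^bsub>op_algebra\<^esub> (U \<otimes>\<^bsub>op_algebra\<^esub> V)"
    by (auto intro!: blinfun_eqI)
  show "(T \<oplus>\<^bsub>op_algebra\<^esub> U) \<otimes>\<^bsub>op_algebra\<^esub> V = T \<otimes>\<^bsub>op_algebra\<^esub> V \<oplus>\<^bsub>op_algebra\<^esub> U \<otimes>\<^bsub>op_algebra\<^esub> V"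
    by (auto intro!: blinfun_eqI simp: blinfun.add_left)
  show "V \<otimes>\<^bsub>op_algebra\<^esub> (T \<oplus>\<^bsub>op_algebra\<^esub> U) = V \<otimes>\<^bsub>op_algebra\<^esub> T \<oplus>\<^bsub>op_algebra\<^esub> V \<otimes>\<^bsub>op_algebra\<^esub> U"
    by (auto intro!: blinfun_eqI simp: blinfun.add_left blinfun.add_right)
qed

text \<open>
  The entry \<open>(i, j)\<close> is stored at the position \<open>prod_encode (i, j)\<close>, so that an
  operator becomes an element of the type over which the universal property of Cuntz--Krieger algebras
  ranges.
\<close>

definition matrix_entries :: "(ell2 \<Rightarrow>\<^sub>L ell2) \<Rightarrow> nat \<Rightarrow> complex" where
  "matrix_entries T n = (case prod_decode n of (i, j) \<Rightarrow> coord (T (basis j)) i)"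

text \<open>
  If an adjointable operator kills all basis vectors, then all coordinates of its adjoint vanish. This
  avoids the density of the span of the basis.
\<close>

lemma inj_matrix_entries: "inj_on matrix_entries adjointable_ops"
proof (rule inj_onI)
  fix T U assume T: "T \<in> adjointable_ops" and U: "U \<in> adjointable_ops"
    and eq: "matrix_entries T = matrix_entries U"
  define D where "D = T + (- U)"
  have D: "D \<in> adjointable_ops"
    unfolding D_def by (intro adjointable_ops_binary(1)[OF T] adjointable_ops_unary(1)[OF U])
  have "T (basis j) = U (basis j)" for j
  proof (rule ell2_eqI)
    show "coord (T (basis j)) i = coord (U (basis j)) i" for i
      using fun_cong[OF eq, of "prod_encode (i, j)"] by (simp add: matrix_entries_def)
  qed
  then have D0: "D (basis j) = 0" for j by (simp add: D_def blinfun.diff_left)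
  have "op_adjoint D y = 0" for y
  proof (rule ell2_eqI)
    fix j
    have "inner (op_adjoint D y) (cscale c (basis j)) = 0" for c
    proof -
      have "inner (op_adjoint D y) (cscale c (basis j)) = inner (D (cscale c (basis j))) y"
        using is_adjoint_op_adjoint[OF D] by (simp add: is_adjoint_def inner_commute)
      then show ?thesis by (simp add: op_cscale[OF D] D0)
    qed
    from this[of 1] this[of \<i>] show "coord (op_adjoint D y) j = coord 0 j"
      by (simp add: inner_basis complex_eq_iff)
  qed
  then have "inner (D x) (D x) = 0" for x
    using is_adjoint_op_adjoint[OF D] by (simp add: is_adjoint_def)
  then have "D = 0" by (intro blinfun_eqI) simp
  then show "T = U" by (simp add: D_def)
qed

section \<open>Contractivity of *-homomorphisms\<close>

context cstar_algebra
begin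

lemma smult_in_carrier: "x \<in> carrier A \<Longrightarrow> c \<odot> x \<in> carrier A"
  by (rule smult_closed) (simp_all add: ring_of_type_algebra_def)

lemma smult_add_left: "x \<in> carrier A \<Longrightarrow> (c + d) \<odot> x = c \<odot> x \<oplus> d \<odot> x"
  using smult_l_distr[of c d x] by (simp add: ring_of_type_algebra_def)

lemma smult_add_right: "x \<in> carrier A \<Longrightarrow> y \<in> carrier A \<Longrightarrow> c \<odot> (x \<oplus> y) = c \<odot> x \<oplus> c \<odot> y"
  using smult_r_distr[of c x y] by (simp add: ring_of_type_algebra_def)

lemma smult_smult: "x \<in> carrier A \<Longrightarrow> c \<odot> (d \<odot> x) = (c * d) \<odot> x"
  using smult_assoc1[of c d x] by (simp add: ring_of_type_algebra_def)

lemma smult_1: "x \<in> carrier A \<Longrightarrow> 1 \<odot> x = x"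
  using smult_one[of x] by (simp add: ring_of_type_algebra_def)

lemma smult_0: "x \<in> carrier A \<Longrightarrow> 0 \<odot> x = \<zero>"
  using smult_l_null[of x] by (simp add: ring_of_type_algebra_def)

lemma a_minus_smult:
  assumes "x \<in> carrier A" "y \<in> carrier A" shows "x \<ominus> y = x \<oplus> (-1) \<odot> y"
proof -
  have "(-1) \<odot> y \<oplus> y = \<zero>"
    using smult_add_left[of y "-1" 1] assms by (simp add: smult_1 smult_0)
  then have "\<ominus> y = (-1) \<odot> y"
    using assms by (intro M.minus_equality) (simp_all add: smult_in_carrier)
  then show ?thesis by (simp add: a_minus_def)
qed

lemma minus_self: "x \<in> carrier A \<Longrightarrow> x \<ominus> x = \<zero>"
  by (simp add: a_minus_def M.r_neg)

lemma minus_zero_right: "x \<in> carrier A \<Longrightarrow> x \<ominus> \<zero> = x"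
  using M.minus_equality[of \<zero> \<zero>] by (simp add: a_minus_def)

lemma nrm_zero: "nrm A \<zero> = 0"
  by (simp add: nrm_eq_zero_iff)

lemma nrm_adj: "x \<in> carrier A \<Longrightarrow> nrm A (adj A x) = nrm A x"
proof -
  have le: "nrm A y \<le> nrm A (adj A y)" if y: "y \<in> carrier A" for y
  proof (cases "nrm A y = 0")
    case True
    then show ?thesis using nrm_nonneg[OF adj_closed[OF y]] by simp
  next
    case False
    have "nrm A y * nrm A y \<le> nrm A (adj A y) * nrm A y"
      using nrm_mult[OF adj_closed[OF y] y] cstar_identity[OF y] by (simp add: power2_eq_square)
    then show ?thesis using False nrm_nonneg[OF y] by (simp add: mult_le_cancel_right)
  qed
  assume x: "x \<in> carrier A"
  show ?thesis using le[OF x] le[OF adj_closed[OF x]] x by (simp add: adj_adj)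
qed

text \<open>
  From \<open>x\<^sup>2 - y\<^sup>2 = x (x - y) + (x - y) y\<close>, which holds without commutativity.
\<close>

lemma nrm_square_difference:
  assumes x: "x \<in> carrier A" and y: "y \<in> carrier A"
  shows "nrm A (x \<otimes> x \<ominus> y \<otimes> y) \<le> (nrm A x + nrm A y) * nrm A (x \<ominus> y)"
proof -
  let ?d = "x \<ominus> y"
  have d: "?d \<in> carrier A" using x y by simp
  have "x \<otimes> ?d \<oplus> ?d \<otimes> y = (x \<otimes> x \<oplus> (-1) \<odot> (x \<otimes> y)) \<oplus> (x \<otimes> y \<oplus> (-1) \<odot> (y \<otimes> y))"
    using x y by (simp add: a_minus_smult distrib_left distrib_right smult_mult_left smult_mult_right
        smult_in_carrier)
  also have "\<dots> = (x \<otimes> x \<oplus> (-1) \<odot> (y \<otimes> y)) \<oplus> (x \<otimes> y \<oplus> (-1) \<odot> (x \<otimes> y))"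
    using x y by (simp add: smult_in_carrier mult_closed M.a_ac)
  also have "x \<otimes> y \<oplus> (-1) \<odot> (x \<otimes> y) = \<zero>"
    using x y by (simp add: mult_closed minus_self flip: a_minus_smult)
  finally have "x \<otimes> x \<ominus> y \<otimes> y = x \<otimes> ?d \<oplus> ?d \<otimes> y"
    using x y by (simp add: a_minus_smult smult_in_carrier mult_closed)
  also have "nrm A \<dots> \<le> nrm A (x \<otimes> ?d) + nrm A (?d \<otimes> y)"
    using x y d by (intro nrm_triangle mult_closed)
  also have "\<dots> \<le> nrm A x * nrm A ?d + nrm A ?d * nrm A y"
    using x y d by (intro add_mono nrm_mult)
  finally show ?thesis by (simp add: algebra_simps)
qed

text \<open>
  In the unitization the equation says \<open>1 - a = (1 - c)\<^sup>2\<close>. It is the fixed point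
  equation \<open>c = (a + c\<^sup>2) / 2\<close>, and with \<open>r = \<parallel>a\<parallel> < 1\<close> the
  right-hand side maps the ball of radius \<open>r\<close> into itself, because
  \<open>(r + r\<^sup>2) / 2 \<le> r\<close>, and contracts distances there by the factor \<open>r\<close>.
  Iteration from \<open>0\<close> converges. The adjoint of the fixed point is again a fixed point in the
  ball, so uniqueness makes it self-adjoint.
\<close>

lemma quasi_square_root:
  assumes a: "a \<in> carrier A" and sa: "adj A a = a" and less: "nrm A a < 1"
  shows "\<exists>c\<in>carrier A. adj A c = c \<and> a = 2 \<odot> c \<oplus> (-1) \<odot> (c \<otimes> c)"
proof -
  interpret Metric_space "carrier A" "cstar_dist A" by (rule Metric_space_cstar_dist)
  let ?d = "cstar_dist A"
  have d: "?d x y = nrm A (x \<ominus> y)" if "x \<in> carrier A" "y \<in> carrier A" for x y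
    using that by (simp add: cstar_dist_def)
  define r where "r = nrm A a"
  have r: "0 \<le> r" "r < 1" using less nrm_nonneg[OF a] by (auto simp: r_def)
  define B where "B = {c \<in> carrier A. nrm A c \<le> r}"
  define \<Phi> where "\<Phi> c = (1/2) \<odot> (a \<oplus> c \<otimes> c)" for c
  have in_A: "\<Phi> c \<in> carrier A" if "c \<in> carrier A" for c
    using a that by (simp add: \<Phi>_def smult_in_carrier mult_closed)
  have in_B: "\<Phi> c \<in> B" if "c \<in> B" for c
  proof -
    have c: "c \<in> carrier A" "nrm A c \<le> r" using that by (auto simp: B_def)
    have "nrm A (\<Phi> c) = 1/2 * nrm A (a \<oplus> c \<otimes> c)"
      using a c by (simp add: \<Phi>_def nrm_smult mult_closed)
    also have "\<dots> \<le> 1/2 * (nrm A a + nrm A c * nrm A c)"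
      using nrm_triangle[of a "c \<otimes> c"] nrm_mult[of c c] a c by (simp add: mult_closed)
    also have "nrm A c * nrm A c \<le> r * 1"
      using c r nrm_nonneg[OF c(1)] by (intro mult_mono) auto
    finally show ?thesis using in_A c by (simp add: B_def r_def)
  qed
  have contraction: "?d (\<Phi> c) (\<Phi> e) \<le> r * ?d c e" if "c \<in> B" "e \<in> B" for c e
  proof -
    have c: "c \<in> carrier A" "e \<in> carrier A" "nrm A c \<le> r" "nrm A e \<le> r"
      using that by (auto simp: B_def)
    have "\<Phi> c \<ominus> \<Phi> e = (1/2) \<odot> ((a \<oplus> c \<otimes> c) \<oplus> (-1) \<odot> (a \<oplus> e \<otimes> e))"
      using a c by (simp add: \<Phi>_def a_minus_smult smult_add_right smult_smult smult_in_carrier mult_closed)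
    also have "(a \<oplus> c \<otimes> c) \<oplus> (-1) \<odot> (a \<oplus> e \<otimes> e)
        = (a \<oplus> (-1) \<odot> a) \<oplus> (c \<otimes> c \<oplus> (-1) \<odot> (e \<otimes> e))"
      using a c by (simp add: smult_add_right smult_in_carrier mult_closed M.a_ac)
    also have "\<dots> = c \<otimes> c \<ominus> e \<otimes> e"
      using a c by (simp add: mult_closed minus_self flip: a_minus_smult)
    finally have "?d (\<Phi> c) (\<Phi> e) = 1/2 * nrm A (c \<otimes> c \<ominus> e \<otimes> e)"
      using c by (simp add: d in_A nrm_smult mult_closed)
    also have "\<dots> \<le> 1/2 * ((nrm A c + nrm A e) * nrm A (c \<ominus> e))"
      using nrm_square_difference c by (intro mult_left_mono) auto
    also have "\<dots> \<le> 1/2 * ((r + r) * nrm A (c \<ominus> e))"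
      using c by (intro mult_left_mono mult_right_mono add_mono nrm_nonneg) auto
    finally show ?thesis using c by (simp add: d)
  qed
  define s where "s n = (\<Phi> ^^ n) \<zero>" for n
  have s_Suc: "s (Suc n) = \<Phi> (s n)" for n by (simp add: s_def)
  have s_B: "s n \<in> B" for n
    by (induction n) (use r in_B in \<open>auto simp: s_Suc\<close>, simp add: s_def B_def nrm_zero)
  have s_A: "s n \<in> carrier A" for n using s_B[of n] by (simp add: B_def)
  have step: "?d (s (n + k)) (s n) \<le> r ^ n * r" for n k
  proof (induction n)
    case 0
    have "nrm A (s k) \<le> r" using s_B[of k] by (simp add: B_def)
    moreover have "s 0 = \<zero>" by (simp add: s_def)
    ultimately show ?case using s_A[of k] by (simp add: d minus_zero_right)
  next
    case (Suc n)
    have "?d (s (Suc n + k)) (s (Suc n)) \<le> r * ?d (s (n + k)) (s n)"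
      using contraction[OF s_B s_B] by (simp add: s_Suc)
    also have "\<dots> \<le> r * (r ^ n * r)" by (rule mult_left_mono[OF Suc r(1)])
    finally show ?case by simp
  qed
  have tail: "\<exists>N. \<forall>n\<ge>N. r ^ n * r < e" if "0 < e" for e
  proof -
    have "(\<lambda>n. r ^ n * r) \<longlonglongrightarrow> 0"
      using r by (intro tendsto_mult_left_zero LIMSEQ_power_zero) auto
    then show ?thesis using that r by (auto simp: LIMSEQ_iff)
  qed
  have "MCauchy s"
    unfolding MCauchy_def
  proof (intro conjI allI impI)
    fix e :: real assume "0 < e"
    then obtain N where N: "\<And>n. n \<ge> N \<Longrightarrow> r ^ n * r < e" using tail by blast
    have "?d (s m) (s n) < e" if "N \<le> n" "n \<le> m" for m n
      using step[of n "m - n"] N[of n] that by simp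
    then show "\<exists>N. \<forall>m n. N \<le> m \<longrightarrow> N \<le> n \<longrightarrow> ?d (s m) (s n) < e"
      by (metis commute nle_le)
  qed (use s_A in auto)
  then obtain c where "limitin mtopology s c sequentially"
    using complete unfolding mcomplete_def by blast
  then have c: "c \<in> carrier A" and lim: "\<And>e. 0 < e \<Longrightarrow> \<exists>N. \<forall>n\<ge>N. ?d (s n) c < e"
    unfolding limit_metric_sequentially by (blast, meson)
  have c_B: "c \<in> B"
  proof -
    have "nrm A c \<le> r + e" if e: "0 < e" for e
    proof -
      obtain n where "?d (s n) c < e" using lim[OF e] by blast
      moreover have "?d c \<zero> = nrm A c" "?d (s n) \<zero> = nrm A (s n)"
        using c s_A[of n] by (simp_all add: d minus_zero_right)
      ultimately show ?thesis
        using triangle[of c "s n" \<zero>] commute[of c "s n"] s_B[of n] c by (simp add: B_def)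
    qed
    then show ?thesis using c by (auto simp: B_def intro: field_le_epsilon)
  qed
  have fixed: "\<Phi> c = c"
  proof -
    have "?d (\<Phi> c) c \<le> 0 + e" if "0 < e" for e
    proof -
      obtain N where N: "\<And>n. n \<ge> N \<Longrightarrow> ?d (s n) c < e / 2" using lim[of "e / 2"] \<open>0 < e\<close> by auto
      have "?d (\<Phi> c) c \<le> ?d (\<Phi> c) (\<Phi> (s N)) + ?d (s (Suc N)) c"
        using triangle[of "\<Phi> c" "\<Phi> (s N)" c] c s_A in_A by (simp add: s_Suc)
      also have "?d (\<Phi> c) (\<Phi> (s N)) \<le> r * ?d c (s N)"
        by (rule contraction[OF c_B s_B])
      also have "r * ?d c (s N) \<le> 1 * ?d c (s N)"
        using r by (intro mult_right_mono) auto
      finally show ?thesis using N[of N] N[of "Suc N"] commute[of c "s N"] by simp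
    qed
    then have "?d (\<Phi> c) c \<le> 0" by (rule field_le_epsilon)
    then show ?thesis using zero[of "\<Phi> c" c] nonneg[of "\<Phi> c" c] c in_A by simp
  qed
  have "adj A c = c"
  proof -
    have B': "adj A c \<in> B" using c_B by (simp add: B_def adj_closed nrm_adj)
    have "\<Phi> (adj A c) = adj A (\<Phi> c)"
      using a c sa by (simp add: \<Phi>_def adj_smult adj_add adj_mult mult_closed)
    then have "?d (adj A c) c \<le> r * ?d (adj A c) c"
      using contraction[OF B' c_B] fixed by simp
    then have "(1 - r) * ?d (adj A c) c \<le> 0" by (simp add: algebra_simps)
    then have "?d (adj A c) c \<le> 0" using r by (simp add: mult_le_0_iff)
    then show ?thesis using zero[of "adj A c" c] nonneg[of "adj A c" c] c adj_closed by simp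
  qed
  moreover have "a = 2 \<odot> c \<oplus> (-1) \<odot> (c \<otimes> c)"
  proof -
    have "2 \<odot> c = 2 \<odot> \<Phi> c" by (simp add: fixed)
    also have "\<dots> = a \<oplus> c \<otimes> c"
      using a c by (simp add: \<Phi>_def smult_smult smult_1 mult_closed)
    finally have "2 \<odot> c \<oplus> (-1) \<odot> (c \<otimes> c) = a \<oplus> (c \<otimes> c \<ominus> c \<otimes> c)"
      using a c by (simp add: a_minus_smult smult_in_carrier mult_closed M.a_assoc)
    then show ?thesis using a c by (simp add: mult_closed minus_self)
  qed
  ultimately show ?thesis using c by blast
qed

lemma star_hom_op_algebra_simps:
  assumes \<pi>: "\<pi> \<in> star_hom A op_algebra"
  shows "x \<in> carrier A \<Longrightarrow> \<pi> x \<in> adjointable_ops"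
    "x \<in> carrier A \<Longrightarrow> y \<in> carrier A \<Longrightarrow> \<pi> (x \<oplus> y) = \<pi> x + \<pi> y"
    "x \<in> carrier A \<Longrightarrow> y \<in> carrier A \<Longrightarrow> \<pi> (x \<otimes> y) = \<pi> x o\<^sub>L \<pi> y"
    "x \<in> carrier A \<Longrightarrow> \<pi> (c \<odot> x) = scalar_op c o\<^sub>L \<pi> x"
    "x \<in> carrier A \<Longrightarrow> \<pi> (adj A x) = op_adjoint (\<pi> x)"
  using \<pi> by (simp_all add: star_hom_def)

lemma star_hom_inner_adj:
  assumes \<pi>: "\<pi> \<in> star_hom A op_algebra" and x: "x \<in> carrier A"
  shows "inner (\<pi> (adj A x) u) v = inner u (\<pi> x v)"
  using is_adjoint_sym[OF is_adjoint_op_adjoint[of "\<pi> x"]] star_hom_op_algebra_simps[OF \<pi>] x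
  by (simp add: is_adjoint_def)

text \<open>
  For \<open>\<parallel>y\<parallel> < 1\<close> write \<open>1 - y* y = (1 - c)\<^sup>2\<close> with
  \<open>c\<close> self-adjoint. Then
  \<open>\<parallel>u\<parallel>\<^sup>2 - \<parallel>\<pi> y u\<parallel>\<^sup>2 = \<parallel>u - \<pi> c u\<parallel>\<^sup>2 \<ge> 0\<close>
  for all vectors \<open>u\<close>. The general case follows by scaling.
\<close>

lemma star_hom_contractive:
  assumes \<pi>: "\<pi> \<in> star_hom A op_algebra" and x: "x \<in> carrier A"
  shows "norm (\<pi> x) \<le> nrm A x"
proof -
  note hom = star_hom_op_algebra_simps[OF \<pi>]
  have unit_ball: "norm (\<pi> y) \<le> 1" if y: "y \<in> carrier A" and less: "nrm A y < 1" for y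
  proof (rule norm_blinfun_bound)
    fix u
    let ?a = "adj A y \<otimes> y"
    have "nrm A ?a < 1"
      using less nrm_nonneg[OF y] by (simp add: cstar_identity[OF y] power_less_one_iff)
    moreover have "adj A ?a = ?a" using y by (simp add: adj_mult adj_closed adj_adj)
    ultimately obtain c where c: "c \<in> carrier A" "adj A c = c"
      and a: "?a = 2 \<odot> c \<oplus> (-1) \<odot> (c \<otimes> c)"
      using quasi_square_root[of ?a] y by (auto simp: mult_closed adj_closed)
    have \<pi>a: "\<pi> ?a u = 2 *\<^sub>R \<pi> c u - \<pi> c (\<pi> c u)"
    proof -
      have "\<pi> ?a u = cscale 2 (\<pi> c u) + cscale (-1) (\<pi> c (\<pi> c u))"
        unfolding a using c by (simp add: hom smult_in_carrier mult_closed blinfun.add_left)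
      then show ?thesis
        using cscale_of_real[of 2] cscale_of_real[of "-1"] by simp
    qed
    have "(norm (\<pi> y u))\<^sup>2 = inner (\<pi> ?a u) u"
      using star_hom_inner_adj[OF \<pi> y] y hom
      by (simp add: power2_norm_eq_inner inner_commute adj_closed)
    also have "\<dots> = 2 * inner (\<pi> c u) u - (norm (\<pi> c u))\<^sup>2"
      using star_hom_inner_adj[OF \<pi> c(1), of "\<pi> c u" u] c(2)
      by (simp add: \<pi>a inner_diff_left power2_norm_eq_inner)
    also have "\<dots> = (norm u)\<^sup>2 - (norm (u - \<pi> c u))\<^sup>2"
      by (simp add: power2_norm_eq_inner inner_diff_left inner_diff_right inner_commute)
    finally have "(norm (\<pi> y u))\<^sup>2 \<le> (norm u)\<^sup>2" by simp
    then show "norm (\<pi> y u) \<le> 1 * norm u" by (simp add: power2_le_iff_abs_le)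
  qed simp
  show ?thesis
  proof (rule dense_ge)
    fix t assume t: "nrm A x < t"
    then have "0 < t" using nrm_nonneg[OF x] by linarith
    have "norm (\<pi> (complex_of_real (1 / t) \<odot> x)) \<le> 1"
      using t \<open>0 < t\<close> x by (intro unit_ball) (simp_all add: smult_in_carrier nrm_smult norm_divide)
    then show "norm (\<pi> x) \<le> t"
      using \<open>0 < t\<close> x by (simp add: hom norm_scalar_op_compose norm_divide)
  qed
qed

end

section \<open>Transport of structure along an injection\<close>

definition transported_algebra :: "('a, 'm) cstar_alg_scheme \<Rightarrow> ('a \<Rightarrow> 'b) \<Rightarrow> 'b cstar_alg" where
  "transported_algebra C f = (let g = the_inv_into (carrier C) f in
     \<lparr>carrier = f ` carrier C, monoid.mult = (\<lambda>x y. f (g x \<otimes>\<^bsub>C\<^esub> g y)), one = f \<one>\<^bsub>C\<^esub>,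
      ring.zero = f \<zero>\<^bsub>C\<^esub>, ring.add = (\<lambda>x y. f (g x \<oplus>\<^bsub>C\<^esub> g y)),
      module.smult = (\<lambda>c x. f (c \<odot>\<^bsub>C\<^esub> g x)),
      cstar_alg.adj = (\<lambda>x. f (adj C (g x))), cstar_alg.nrm = (\<lambda>x. nrm C (g x))\<rparr>)"

context
  fixes C :: "('a, 'm) cstar_alg_scheme" and f :: "'a \<Rightarrow> 'b"
  assumes C: "cstar_algebra C" and inj: "inj_on f (carrier C)"
begin

interpretation C: cstar_algebra C by (rule C)

private abbreviation "D \<equiv> transported_algebra C f"

lemma transported_simps:
  "carrier D = f ` carrier C" "\<zero>\<^bsub>D\<^esub> = f \<zero>\<^bsub>C\<^esub>"
  "x \<in> carrier C \<Longrightarrow> y \<in> carrier C \<Longrightarrow> f x \<otimes>\<^bsub>D\<^esub> f y = f (x \<otimes>\<^bsub>C\<^esub> y)"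
  "x \<in> carrier C \<Longrightarrow> y \<in> carrier C \<Longrightarrow> f x \<oplus>\<^bsub>D\<^esub> f y = f (x \<oplus>\<^bsub>C\<^esub> y)"
  "x \<in> carrier C \<Longrightarrow> c \<odot>\<^bsub>D\<^esub> f x = f (c \<odot>\<^bsub>C\<^esub> x)"
  "x \<in> carrier C \<Longrightarrow> adj D (f x) = f (adj C x)"
  "x \<in> carrier C \<Longrightarrow> nrm D (f x) = nrm C x"
  using the_inv_into_f_f[OF inj] by (simp_all add: transported_algebra_def Let_def)

private lemmas C_scalar = C.smult_in_carrier C.smult_add_left C.smult_add_right C.smult_smult C.smult_1

lemma abelian_group_transported: "abelian_group D"
proof (rule abelian_groupI)
  show "\<exists>y\<in>carrier D. y \<oplus>\<^bsub>D\<^esub> x = \<zero>\<^bsub>D\<^esub>" if x: "x \<in> carrier D" for x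
  proof -
    obtain u where "u \<in> carrier C" "x = f u" using x by (auto simp: transported_simps)
    then show ?thesis
      by (intro bexI[of _ "f (\<ominus>\<^bsub>C\<^esub> u)"]) (auto simp: transported_simps C.M.l_neg)
  qed
qed (auto simp: transported_simps C.M.a_assoc intro: arg_cong[OF C.M.a_comm])

lemma transported_minus:
  assumes "x \<in> carrier C" "y \<in> carrier C"
  shows "f x \<ominus>\<^bsub>D\<^esub> f y = f (x \<ominus>\<^bsub>C\<^esub> y)"
proof -
  interpret D: abelian_group D by (rule abelian_group_transported)
  have "\<ominus>\<^bsub>D\<^esub> f y = f (\<ominus>\<^bsub>C\<^esub> y)"
    using assms by (intro D.minus_equality) (simp_all add: transported_simps C.M.l_neg)
  then show ?thesis using assms by (simp add: a_minus_def transported_simps)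
qed

lemma transported_finsum:
  assumes "finite F" "\<And>i. i \<in> F \<Longrightarrow> h i \<in> carrier C"
  shows "finsum D (\<lambda>i. f (h i)) F = f (finsum C h F)"
proof -
  interpret D: abelian_group D by (rule abelian_group_transported)
  show ?thesis
    using assms by (induction F rule: finite_induct)
      (simp_all add: Pi_def transported_simps C.M.finsum_closed)
qed

lemma transported_dist:
  "x \<in> carrier C \<Longrightarrow> y \<in> carrier C \<Longrightarrow> cstar_dist D (f x) (f y) = cstar_dist C x y"
  by (simp add: cstar_dist_def transported_simps transported_minus)

lemma complete_transported: "Metric_space.mcomplete (carrier D) (cstar_dist D)"
proof -
  interpret MC: Metric_space "carrier C" "cstar_dist C" by (rule C.Metric_space_cstar_dist)
  interpret MD: Metric_space "carrier D" "cstar_dist D"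
  proof
    show "0 \<le> cstar_dist D x y" for x y
      by (auto simp: cstar_dist_def transported_simps transported_minus C.nrm_nonneg)
    show "cstar_dist D x y = cstar_dist D y x" for x y
    proof (cases "x \<in> carrier D \<and> y \<in> carrier D")
      case True
      then show ?thesis by (auto simp: transported_simps transported_dist MC.commute)
    qed (auto simp: cstar_dist_def)
  qed (auto simp: transported_simps(1) transported_dist MC.triangle inj_on_eq_iff[OF inj])
  show ?thesis unfolding MD.mcomplete_def
  proof (intro allI impI)
    fix \<sigma> assume \<sigma>: "MD.MCauchy \<sigma>"
    then have "range \<sigma> \<subseteq> f ` carrier C"
      unfolding MD.MCauchy_def by (simp add: transported_simps(1))
    then have "\<forall>n. \<exists>x. x \<in> carrier C \<and> \<sigma> n = f x" by auto
    then obtain \<tau> where \<tau>: "\<And>n. \<tau> n \<in> carrier C" "\<And>n. \<sigma> n = f (\<tau> n)" by metis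
    then have "MC.MCauchy \<tau>"
      using \<sigma> by (auto simp: MD.MCauchy_def MC.MCauchy_def transported_dist)
    then obtain x where "limitin MC.mtopology \<tau> x sequentially"
      using C.complete unfolding MC.mcomplete_def by blast
    then have "limitin MD.mtopology \<sigma> (f x) sequentially"
      using \<tau> unfolding MC.limit_metric_sequentially MD.limit_metric_sequentially
      by (simp add: transported_dist transported_simps(1))
    then show "\<exists>x. limitin MD.mtopology \<sigma> x sequentially" by blast
  qed
qed

lemma cstar_algebra_transported: "cstar_algebra D"
proof (intro cstar_algebra.intro cstar_algebra_axioms.intro)
  show "Module.module (ring_of_type_algebra :: complex ring) D"
    by (rule moduleI[OF cring_from_type_algebra abelian_group_transported])
      (auto simp: ring_of_type_algebra_def transported_simps C_scalar)
  fix x y z c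
  show "Metric_space.mcomplete (carrier D) (cstar_dist D)" by (rule complete_transported)
  assume "x \<in> carrier D"
  then obtain u where u: "u \<in> carrier C" "x = f u" by (auto simp: transported_simps)
  note C_closed = C.mult_closed C.adj_closed C_scalar(1)
  show "adj D x \<in> carrier D" "adj D (adj D x) = x"
    "adj D (c \<odot>\<^bsub>D\<^esub> x) = cnj c \<odot>\<^bsub>D\<^esub> adj D x" "0 \<le> nrm D x"
    "nrm D (c \<odot>\<^bsub>D\<^esub> x) = cmod c * nrm D x" "nrm D (adj D x \<otimes>\<^bsub>D\<^esub> x) = (nrm D x)\<^sup>2"
    using u by (simp_all add: transported_simps C_closed C.adj_adj C.adj_smult C.nrm_nonneg
        C.nrm_smult C.cstar_identity)
  show "nrm D x = 0 \<longleftrightarrow> x = \<zero>\<^bsub>D\<^esub>"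
    using u by (simp add: transported_simps C.nrm_eq_zero_iff inj_on_eq_iff[OF inj])
  assume "y \<in> carrier D"
  then obtain v where v: "v \<in> carrier C" "y = f v" by (auto simp: transported_simps)
  show "x \<otimes>\<^bsub>D\<^esub> y \<in> carrier D" "(c \<odot>\<^bsub>D\<^esub> x) \<otimes>\<^bsub>D\<^esub> y = c \<odot>\<^bsub>D\<^esub> (x \<otimes>\<^bsub>D\<^esub> y)"
    "x \<otimes>\<^bsub>D\<^esub> (c \<odot>\<^bsub>D\<^esub> y) = c \<odot>\<^bsub>D\<^esub> (x \<otimes>\<^bsub>D\<^esub> y)" "adj D (x \<oplus>\<^bsub>D\<^esub> y) = adj D x \<oplus>\<^bsub>D\<^esub> adj D y"
    "adj D (x \<otimes>\<^bsub>D\<^esub> y) = adj D y \<otimes>\<^bsub>D\<^esub> adj D x" "nrm D (x \<oplus>\<^bsub>D\<^esub> y) \<le> nrm D x + nrm D y"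
    "nrm D (x \<otimes>\<^bsub>D\<^esub> y) \<le> nrm D x * nrm D y"
    using u v by (simp_all add: transported_simps C_closed C.smult_mult_left C.smult_mult_right
        C.adj_add C.adj_mult C.nrm_triangle C.nrm_mult)
  assume "z \<in> carrier D"
  then obtain w where w: "w \<in> carrier C" "z = f w" by (auto simp: transported_simps)
  show "x \<otimes>\<^bsub>D\<^esub> y \<otimes>\<^bsub>D\<^esub> z = x \<otimes>\<^bsub>D\<^esub> (y \<otimes>\<^bsub>D\<^esub> z)"
    "(x \<oplus>\<^bsub>D\<^esub> y) \<otimes>\<^bsub>D\<^esub> z = x \<otimes>\<^bsub>D\<^esub> z \<oplus>\<^bsub>D\<^esub> y \<otimes>\<^bsub>D\<^esub> z"
    "x \<otimes>\<^bsub>D\<^esub> (y \<oplus>\<^bsub>D\<^esub> z) = x \<otimes>\<^bsub>D\<^esub> y \<oplus>\<^bsub>D\<^esub> x \<otimes>\<^bsub>D\<^esub> z"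
    using u v w by (simp_all add: transported_simps C_closed C.mult_assoc C.distrib_left C.distrib_right)
qed

lemma ck_family_transported:
  assumes wf: "wf_digraph G" and ck: "ck_family G C Q T"
  shows "ck_family G D (\<lambda>v. f (Q v)) (\<lambda>e. f (T e))"
proof -
  have Q: "Q v \<in> carrier C" if "v \<in> verts G" for v
    using ck that by (simp add: ck_family_def projection_def)
  have T: "T e \<in> carrier C" if "e \<in> arcs G" for e
    using ck that by (simp add: ck_family_def partial_isometry_def)
  have Q_tail: "Q (tail G e) \<in> carrier C" if "e \<in> arcs G" for e
    using Q wf that by (simp add: wf_digraph_def)
  note closed = C.mult_closed C.adj_closed
  have sum: "(\<Oplus>\<^bsub>D\<^esub>e\<in>F. f (T e) \<otimes>\<^bsub>D\<^esub> adj D (f (T e))) = f (\<Oplus>\<^bsub>C\<^esub>e\<in>F. T e \<otimes>\<^bsub>C\<^esub> adj C (T e))"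
    and sum_closed: "(\<Oplus>\<^bsub>C\<^esub>e\<in>F. T e \<otimes>\<^bsub>C\<^esub> adj C (T e)) \<in> carrier C"
    if F: "finite F" "F \<subseteq> in_arcs G v" for F v
  proof -
    interpret D: abelian_group D by (rule abelian_group_transported)
    have F': "T e \<in> carrier C" if "e \<in> F" for e using T F that by auto
    have "(\<Oplus>\<^bsub>D\<^esub>e\<in>F. f (T e) \<otimes>\<^bsub>D\<^esub> adj D (f (T e))) = (\<Oplus>\<^bsub>D\<^esub>e\<in>F. f (T e \<otimes>\<^bsub>C\<^esub> adj C (T e)))"
      by (rule D.finsum_cong') (auto simp: transported_simps closed F')
    also have "\<dots> = f (\<Oplus>\<^bsub>C\<^esub>e\<in>F. T e \<otimes>\<^bsub>C\<^esub> adj C (T e))"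
      by (rule transported_finsum[OF F(1)]) (simp add: closed F')
    finally show "(\<Oplus>\<^bsub>D\<^esub>e\<in>F. f (T e) \<otimes>\<^bsub>D\<^esub> adj D (f (T e))) = f (\<Oplus>\<^bsub>C\<^esub>e\<in>F. T e \<otimes>\<^bsub>C\<^esub> adj C (T e))" .
    show "(\<Oplus>\<^bsub>C\<^esub>e\<in>F. T e \<otimes>\<^bsub>C\<^esub> adj C (T e)) \<in> carrier C"
      by (rule C.M.finsum_closed) (auto simp: closed F')
  qed
  have le: "cstar_le D (f x) (f y)" if "cstar_le C x y" "x \<in> carrier C" "y \<in> carrier C" for x y
  proof -
    obtain b where "b \<in> carrier C" "y \<ominus>\<^bsub>C\<^esub> x = adj C b \<otimes>\<^bsub>C\<^esub> b"
      using \<open>cstar_le C x y\<close> by (auto simp: cstar_le_def cstar_positive_def)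
    then show ?thesis using that unfolding cstar_le_def cstar_positive_def
      by (intro bexI[of _ "f b"]) (simp_all add: transported_minus transported_simps closed)
  qed
  show ?thesis
    unfolding ck_family_def
  proof (intro conjI ballI allI impI)
    fix v assume v: "v \<in> verts G"
    show "projection D (f (Q v))"
      using ck v Q[OF v] by (simp add: ck_family_def projection_def transported_simps)
    show "f (Q v) \<otimes>\<^bsub>D\<^esub> f (Q w) = \<zero>\<^bsub>D\<^esub>" if "w \<in> verts G" "v \<noteq> w" for w
      using ck v that Q by (simp add: ck_family_def transported_simps)
    show "cstar_le D (\<Oplus>\<^bsub>D\<^esub>e\<in>F. f (T e) \<otimes>\<^bsub>D\<^esub> adj D (f (T e))) (f (Q v))"
      if F: "finite F \<and> F \<subseteq> in_arcs G v" for F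
      using ck v F Q[OF v] le sum_closed[of F v] by (simp add: ck_family_def sum[of F v])
    show "(\<Oplus>\<^bsub>D\<^esub>e\<in>in_arcs G v. f (T e) \<otimes>\<^bsub>D\<^esub> adj D (f (T e))) = f (Q v)"
      if "in_arcs G v \<noteq> {} \<and> finite (in_arcs G v)"
      using ck v that by (simp add: ck_family_def sum[of _ v])
  next
    fix e assume e: "e \<in> arcs G"
    show "partial_isometry D (f (T e))"
      using ck e T[OF e] by (simp add: ck_family_def partial_isometry_def transported_simps closed)
    show "adj D (f (T e)) \<otimes>\<^bsub>D\<^esub> f (T e) = f (Q (tail G e))"
      using ck e T[OF e] by (simp add: ck_family_def transported_simps closed)
  qed
qed

lemma star_hom_transported_inverse:
  assumes "\<pi> \<in> star_hom A D"
  shows "(\<lambda>x. the_inv_into (carrier C) f (\<pi> x)) \<in> star_hom A C"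
proof -
  let ?g = "the_inv_into (carrier C) f"
  have g: "?g x \<in> carrier C" "f (?g x) = x" if "x \<in> carrier D" for x
    using that the_inv_into_into[OF inj _ subset_refl] f_the_inv_into_f[OF inj]
    by (auto simp: transported_simps)
  have gf: "?g (f u) = u" if "u \<in> carrier C" for u by (rule the_inv_into_f_f[OF inj that])
  have "?g (x \<oplus>\<^bsub>D\<^esub> y) = ?g x \<oplus>\<^bsub>C\<^esub> ?g y" "?g (x \<otimes>\<^bsub>D\<^esub> y) = ?g x \<otimes>\<^bsub>C\<^esub> ?g y"
    if xy: "x \<in> carrier D" "y \<in> carrier D" for x y
    using xy by (auto simp: transported_simps gf C.mult_closed)
  moreover have "?g (c \<odot>\<^bsub>D\<^esub> x) = c \<odot>\<^bsub>C\<^esub> ?g x" "?g (adj D x) = adj C (?g x)"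
    if "x \<in> carrier D" for c x
    using that by (auto simp: transported_simps gf C.adj_closed C_scalar)
  ultimately show ?thesis using assms g(1) by (simp add: star_hom_def)
qed

end

text \<open>
  The universal property extends to C*-algebras on other types of at most the cardinality of the
  continuum: copy the algebra into \<open>nat \<Rightarrow> complex\<close>, and compose the homomorphism
  found there with the inverse of the copying map.
\<close>

lemma ck_algebra_universal:
  assumes A: "is_ck_algebra G A P S" and wf: "wf_digraph G"
    and C: "cstar_algebra C" and inj: "inj_on (f :: 'c \<Rightarrow> nat \<Rightarrow> complex) (carrier C)"
    and ck: "ck_family G C Q T"
  shows "\<exists>\<pi>\<in>star_hom A C. (\<forall>v\<in>verts G. \<pi> (P v) = Q v) \<and> (\<forall>e\<in>arcs G. \<pi> (S e) = T e)"
proof -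
  let ?g = "the_inv_into (carrier C) f"
  have Q: "Q v \<in> carrier C" if "v \<in> verts G" for v
    using ck that by (simp add: ck_family_def projection_def)
  have T: "T e \<in> carrier C" if "e \<in> arcs G" for e
    using ck that by (simp add: ck_family_def partial_isometry_def)
  obtain \<pi> where \<pi>: "\<pi> \<in> star_hom A (transported_algebra C f)"
    "\<forall>v\<in>verts G. \<pi> (P v) = f (Q v)" "\<forall>e\<in>arcs G. \<pi> (S e) = f (T e)"
    using A cstar_algebra_transported[OF C inj] ck_family_transported[OF C inj wf ck]
    unfolding is_ck_algebra_def by blast
  then show ?thesis
    using star_hom_transported_inverse[OF C inj \<pi>(1)] Q T
    by (intro bexI[of _ "\<lambda>x. ?g (\<pi> x)"]) (simp_all add: the_inv_into_f_f[OF inj])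
qed

section \<open>Cuntz--Krieger families of operators\<close>

text \<open>
  Partial injections of the index set come as pairs of mutually inverse partial functions, because the
  inverse induces the adjoint operator.
\<close>

definition mutually_inverse :: "(nat \<Rightarrow> nat option) \<Rightarrow> (nat \<Rightarrow> nat option) \<Rightarrow> bool" where
  "mutually_inverse p q \<longleftrightarrow> (\<forall>j k. p k = Some j \<longleftrightarrow> q j = Some k)"

definition pullback :: "(nat \<Rightarrow> nat option) \<Rightarrow> (nat \<Rightarrow> complex) \<Rightarrow> nat \<Rightarrow> complex" where
  "pullback p x k = (case p k of None \<Rightarrow> 0 | Some j \<Rightarrow> x j)"

definition pullback_op :: "(nat \<Rightarrow> nat option) \<Rightarrow> ell2 \<Rightarrow>\<^sub>L ell2" where
  "pullback_op p = Blinfun (\<lambda>x. Abs_ell2 (pullback p (coord x)))"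

lemma mutually_inverse_sym: "mutually_inverse p q \<Longrightarrow> mutually_inverse q p"
  by (auto simp: mutually_inverse_def)

lemma mutually_inverse_bij_betw:
  assumes "mutually_inverse p q"
  shows "bij_betw (\<lambda>k. the (p k)) (dom p) (dom q)"
proof (rule bij_betwI[where g = "\<lambda>j. the (q j)"])
  have pq: "p k = Some j \<longleftrightarrow> q j = Some k" for j k using assms by (simp add: mutually_inverse_def)
  show "(\<lambda>k. the (p k)) \<in> dom p \<rightarrow> dom q" "(\<lambda>j. the (q j)) \<in> dom q \<rightarrow> dom p"
    using pq by fastforce+
  show "the (q (the (p k))) = k" if "k \<in> dom p" for k
  proof -
    from that obtain j where j: "p k = Some j" by blast
    then have "q j = Some k" by (simp add: pq)
    with j show ?thesis by simp
  qed
  show "the (p (the (q j))) = j" if "j \<in> dom q" for j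
  proof -
    from that obtain k where k: "q j = Some k" by blast
    then have "p k = Some j" by (simp add: pq)
    with k show ?thesis by simp
  qed
qed

lemma infsum_pullback:
  fixes h :: "nat \<Rightarrow> nat \<Rightarrow> real"
  assumes "mutually_inverse p q"
  shows "(\<Sum>\<^sub>\<infinity>k. case p k of None \<Rightarrow> 0 | Some j \<Rightarrow> h j k)
       = (\<Sum>\<^sub>\<infinity>j. case q j of None \<Rightarrow> 0 | Some k \<Rightarrow> h j k)"
proof -
  have "(\<Sum>\<^sub>\<infinity>k. case p k of None \<Rightarrow> 0 | Some j \<Rightarrow> h j k) = (\<Sum>\<^sub>\<infinity>k\<in>dom p. h (the (p k)) (the (q (the (p k)))))"
    by (rule infsum_cong_neutral)
      (use assms in \<open>auto simp: mutually_inverse_def split: option.split, metis option.sel\<close>)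
  also have "\<dots> = (\<Sum>\<^sub>\<infinity>j\<in>dom q. h j (the (q j)))"
    by (rule infsum_reindex_bij_betw[OF mutually_inverse_bij_betw[OF assms], of "\<lambda>j. h j (the (q j))"])
  also have "\<dots> = (\<Sum>\<^sub>\<infinity>j. case q j of None \<Rightarrow> 0 | Some k \<Rightarrow> h j k)"
    by (rule infsum_cong_neutral) (auto split: option.split)
  finally show ?thesis .
qed

lemma square_summable_pullback:
  assumes pq: "mutually_inverse p q"
  shows "(\<lambda>k. (cmod (pullback p (coord x) k))\<^sup>2) summable_on UNIV"
    and "(\<Sum>\<^sub>\<infinity>k. (cmod (pullback p (coord x) k))\<^sup>2) \<le> (norm x)\<^sup>2"
proof -
  have dom_q: "(\<lambda>j. (cmod (coord x j))\<^sup>2) summable_on dom q"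
    by (rule summable_on_subset_banach[OF square_summable_coord]) simp
  have "(\<lambda>k. (cmod (coord x (the (p k))))\<^sup>2) summable_on dom p"
    using dom_q summable_on_reindex_bij_betw[OF mutually_inverse_bij_betw[OF pq], of "\<lambda>j. (cmod (coord x j))\<^sup>2"]
    by simp
  also have "?this \<longleftrightarrow> (\<lambda>k. (cmod (pullback p (coord x) k))\<^sup>2) summable_on UNIV"
    by (rule summable_on_cong_neutral) (auto simp: pullback_def split: option.split)
  finally show "(\<lambda>k. (cmod (pullback p (coord x) k))\<^sup>2) summable_on UNIV" .
  have "(\<Sum>\<^sub>\<infinity>k. (cmod (pullback p (coord x) k))\<^sup>2) = (\<Sum>\<^sub>\<infinity>k\<in>dom p. (cmod (coord x (the (p k))))\<^sup>2)"
    by (rule infsum_cong_neutral) (auto simp: pullback_def split: option.split)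
  also have "\<dots> = (\<Sum>\<^sub>\<infinity>j\<in>dom q. (cmod (coord x j))\<^sup>2)"
    by (rule infsum_reindex_bij_betw[OF mutually_inverse_bij_betw[OF pq], of "\<lambda>j. (cmod (coord x j))\<^sup>2"])
  also have "\<dots> \<le> (norm x)\<^sup>2"
    unfolding norm_ell2_square by (rule infsum_mono2[OF dom_q square_summable_coord]) auto
  finally show "(\<Sum>\<^sub>\<infinity>k. (cmod (pullback p (coord x) k))\<^sup>2) \<le> (norm x)\<^sup>2" .
qed

lemma coord_pullback_op:
  assumes pq: "mutually_inverse p q"
  shows "coord (pullback_op p x) k = (case p k of None \<Rightarrow> 0 | Some j \<Rightarrow> coord x j)"
proof -
  let ?f = "\<lambda>x. Abs_ell2 (pullback p (coord x))"
  have coord_f: "coord (?f x) = pullback p (coord x)" for x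
    using square_summable_pullback(1)[OF pq] by (simp add: Abs_ell2_inverse)
  have "bounded_linear ?f"
  proof (rule bounded_linear_intro)
    show "?f (x + y) = ?f x + ?f y" for x y
      by (rule ell2_eqI) (simp add: coord_f, simp add: pullback_def split: option.split)
    show "?f (r *\<^sub>R x) = r *\<^sub>R ?f x" for r x
      by (rule ell2_eqI) (simp add: coord_f coord_scaleR, simp add: pullback_def coord_scaleR split: option.split)
    show "norm (?f x) \<le> norm x * 1" for x
      using square_summable_pullback(2)[OF pq, of x]
      by (simp add: coord_f power2_le_iff_abs_le flip: norm_ell2_square[of "?f x", unfolded coord_f])
  qed
  then show ?thesis
    by (simp add: pullback_op_def bounded_linear_Blinfun_apply coord_f) (simp add: pullback_def)
qed

lemma is_adjoint_pullback_op:
  assumes pq: "mutually_inverse p q"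
  shows "is_adjoint (pullback_op p) (pullback_op q)"
  unfolding is_adjoint_def
proof (intro allI)
  fix x y
  have "inner (pullback_op p x) y
      = (\<Sum>\<^sub>\<infinity>k. case p k of None \<Rightarrow> 0 | Some j \<Rightarrow> inner (coord x j) (coord y k))"
    unfolding inner_ell2_def by (rule infsum_cong) (simp add: coord_pullback_op[OF pq] split: option.split)
  also have "\<dots> = (\<Sum>\<^sub>\<infinity>j. case q j of None \<Rightarrow> 0 | Some k \<Rightarrow> inner (coord x j) (coord y k))"
    by (rule infsum_pullback[OF pq])
  also have "\<dots> = inner x (pullback_op q y)"
    unfolding inner_ell2_def
    by (rule infsum_cong) (simp add: coord_pullback_op[OF mutually_inverse_sym[OF pq]] split: option.split)
  finally show "inner (pullback_op p x) y = inner x (pullback_op q y)" .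
qed

lemma pullback_op_adjointable:
  assumes pq: "mutually_inverse p q" shows "pullback_op p \<in> adjointable_ops"
  by (rule adjointable_opsI[OF is_adjoint_pullback_op[OF pq]], rule ell2_eqI)
    (simp add: coord_pullback_op[OF pq] split: option.split)

definition coord_projection :: "nat set \<Rightarrow> ell2 \<Rightarrow>\<^sub>L ell2" where
  "coord_projection M = pullback_op (\<lambda>k. if k \<in> M then Some k else None)"

lemma coord_coord_projection: "coord (coord_projection M x) k = (if k \<in> M then coord x k else 0)"
  and coord_projection_adjointable: "coord_projection M \<in> adjointable_ops"
  and adjoint_coord_projection: "op_adjoint (coord_projection M) = coord_projection M"
proof -
  have inv: "mutually_inverse (\<lambda>k. if k \<in> M then Some k else None) (\<lambda>k. if k \<in> M then Some k else None)"
    by (auto simp: mutually_inverse_def)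
  show "coord (coord_projection M x) k = (if k \<in> M then coord x k else 0)"
    by (simp add: coord_projection_def coord_pullback_op[OF inv])
  show "coord_projection M \<in> adjointable_ops"
    unfolding coord_projection_def by (rule pullback_op_adjointable[OF inv])
  show "op_adjoint (coord_projection M) = coord_projection M"
    unfolding coord_projection_def by (rule adjoint_eqI[OF is_adjoint_pullback_op[OF inv]])
qed

lemma coord_projection_compose: "coord_projection M o\<^sub>L coord_projection N = coord_projection (M \<inter> N)"
  by (intro blinfun_eqI ell2_eqI) (simp add: coord_coord_projection)

lemma coord_projection_empty: "coord_projection {} = 0"
  by (intro blinfun_eqI ell2_eqI) (simp add: coord_coord_projection)

lemma coord_projection_diff:
  "M \<subseteq> N \<Longrightarrow> coord_projection N - coord_projection M = coord_projection (N - M)"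
  by (intro blinfun_eqI ell2_eqI) (auto simp: coord_coord_projection blinfun.diff_left)

lemma coord_projection_UN:
  assumes "finite F" "disjoint_family_on R F"
  shows "(\<Sum>i\<in>F. coord_projection (R i)) = coord_projection (\<Union>i\<in>F. R i)"
  using assms
proof (induction F rule: finite_induct)
  case empty
  then show ?case by (simp add: coord_projection_empty)
next
  case (insert i F)
  have disj: "R i \<inter> (\<Union>j\<in>F. R j) = {}"
    using insert.prems insert.hyps(2) by (auto simp: disjoint_family_on_def)
  have "disjoint_family_on R F" using insert.prems by (auto simp: disjoint_family_on_def)
  then have "(\<Sum>j\<in>insert i F. coord_projection (R j)) = coord_projection (R i) + coord_projection (\<Union>j\<in>F. R j)"
    using insert.hyps insert.IH by simp
  also have "\<dots> = coord_projection (\<Union>j\<in>insert i F. R j)"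
    using disj by (intro blinfun_eqI ell2_eqI) (auto simp: coord_coord_projection blinfun.add_left)
  finally show ?case .
qed

lemma coord_projection_le:
  assumes "M \<subseteq> N"
  shows "cstar_le op_algebra (coord_projection M) (coord_projection N)"
proof -
  have "coord_projection N \<ominus>\<^bsub>op_algebra\<^esub> coord_projection M
      = op_adjoint (coord_projection (N - M)) o\<^sub>L coord_projection (N - M)"
    by (simp add: op_algebra_minus coord_projection_adjointable coord_projection_diff[OF assms]
        adjoint_coord_projection coord_projection_compose)
  then show ?thesis
    by (auto simp: cstar_le_def cstar_positive_def coord_projection_adjointable)
qed

text \<open>
  A bijection from \<open>R\<close> to \<open>D\<close> induces an operator that carries the basis
  vectors of \<open>D\<close> to those of \<open>R\<close> and kills the others.
\<close>

lemma partial_isometry_op_exists: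
  assumes "infinite R" "infinite D"
  shows "\<exists>T\<in>adjointable_ops. op_adjoint T o\<^sub>L T = coord_projection D \<and> T o\<^sub>L op_adjoint T = coord_projection R"
proof -
  have "bij_betw (from_nat_into D \<circ> to_nat_on R) R D"
    by (rule bij_betw_trans) (use assms in \<open>auto intro!: to_nat_on_infinite bij_betw_from_nat_into\<close>)
  then obtain b where b: "bij_betw b R D" by blast
  define b' where "b' = the_inv_into R b"
  have b': "b' j \<in> R" "b (b' j) = j" if "j \<in> D" for j
    using b that unfolding b'_def bij_betw_def
    by (auto simp: the_inv_into_into f_the_inv_into_f)
  have bb: "b k \<in> D" "b' (b k) = k" if "k \<in> R" for k
    using b that unfolding b'_def bij_betw_def by (auto simp: the_inv_into_f_f)
  define p where "p k = (if k \<in> R then Some (b k) else None)" for k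
  define q where "q j = (if j \<in> D then Some (b' j) else None)" for j
  have pq: "mutually_inverse p q"
    using b' bb by (auto simp: mutually_inverse_def p_def q_def split: if_splits)
  note qp = mutually_inverse_sym[OF pq]
  have "op_adjoint (pullback_op p) = pullback_op q" by (rule adjoint_eqI[OF is_adjoint_pullback_op[OF pq]])
  moreover have "pullback_op q o\<^sub>L pullback_op p = coord_projection D"
    by (intro blinfun_eqI ell2_eqI)
      (auto simp: coord_coord_projection coord_pullback_op[OF pq] coord_pullback_op[OF qp] p_def q_def b')
  moreover have "pullback_op p o\<^sub>L pullback_op q = coord_projection R"
    by (intro blinfun_eqI ell2_eqI)
      (auto simp: coord_coord_projection coord_pullback_op[OF pq] coord_pullback_op[OF qp] p_def q_def bb)
  ultimately show ?thesis
    using pullback_op_adjointable[OF pq] by (intro bexI[of _ "pullback_op p"]) auto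
qed

text \<open>
  A bijection of \<open>I \<times> nat\<close> with \<open>M\<close> cuts \<open>M\<close> into the images of the
  rows.
\<close>

lemma infinite_disjoint_partition:
  fixes M :: "nat set"
  assumes M: "infinite M" and I: "countable I"
  shows "\<exists>R. (\<forall>i\<in>I. infinite (R i)) \<and> disjoint_family_on R I \<and> (I \<noteq> {} \<longrightarrow> (\<Union>i\<in>I. R i) = M)"
proof (cases "I = {}")
  case False
  let ?X = "I \<times> (UNIV :: nat set)"
  have X: "countable ?X" "infinite ?X"
    using I False by (auto simp: finite_cartesian_product_iff)
  have "bij_betw (from_nat_into M \<circ> to_nat_on ?X) ?X M"
    by (rule bij_betw_trans[OF to_nat_on_infinite[OF X]]) (use M in \<open>auto intro: bij_betw_from_nat_into\<close>)
  then obtain h where h: "bij_betw h ?X M" by blast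
  define R where "R i = h ` ({i} \<times> UNIV)" for i
  have "infinite (R i)" if "i \<in> I" for i
  proof -
    have "inj_on h ({i} \<times> UNIV)"
      using h that by (auto simp: bij_betw_def intro: inj_on_subset)
    then show ?thesis by (simp add: R_def finite_image_iff finite_cartesian_product_iff)
  qed
  moreover have "disjoint_family_on R I"
    unfolding disjoint_family_on_def
  proof (intro ballI impI)
    fix i j assume "i \<in> I" "j \<in> I" "i \<noteq> j"
    then have "R i \<inter> R j = h ` (({i} \<times> UNIV) \<inter> ({j} \<times> UNIV))"
      unfolding R_def by (intro inj_on_image_Int[symmetric, of h ?X]) (use h in \<open>auto simp: bij_betw_def\<close>)
    then show "R i \<inter> R j = {}" using \<open>i \<noteq> j\<close> by auto
  qed
  moreover have "(\<Union>i\<in>I. R i) = M"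
    using h by (auto simp: R_def bij_betw_def)
  ultimately show ?thesis by blast
qed (simp add: disjoint_family_on_def)

text \<open>
  Give each vertex an infinite set \<open>D v\<close> of basis vectors, disjoint from those of the other
  vertices, and divide \<open>D v\<close> among the edges that \<open>v\<close> receives into infinite
  parts. An edge then acts as a bijection from the basis vectors of its source onto its own part. As the
  parts exhaust \<open>D v\<close> whenever \<open>v\<close> receives an edge, equality holds in the
  Cuntz--Krieger relation. Infinite receivers are treated in the same way: there the
  parts exhaust \<open>D v\<close> only in the limit, so finite subsums stay below the projection.
\<close>

lemma ck_family_op_algebra_exists:
  assumes wf: "wf_digraph G" and V: "countable (verts G)" and E: "countable (arcs G)"
  shows "\<exists>D T. (\<forall>v\<in>verts G. D v \<noteq> {}) \<and> ck_family G op_algebra (\<lambda>v. coord_projection (D v)) T"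
proof -
  from infinite_disjoint_partition[OF infinite_UNIV_nat V]
  obtain D :: "_ \<Rightarrow> nat set" where D': "\<forall>v\<in>verts G. infinite (D v)"
    and D_disj: "disjoint_family_on D (verts G)"
    by (elim exE conjE)
  then have D: "infinite (D v)" if "v \<in> verts G" for v using that by simp
  have "countable (in_arcs G v)" for v
    by (rule countable_subset[OF _ E]) auto
  then have "\<forall>v\<in>verts G. \<exists>R. (\<forall>e\<in>in_arcs G v. infinite (R e)) \<and> disjoint_family_on R (in_arcs G v) \<and>
      (in_arcs G v \<noteq> {} \<longrightarrow> (\<Union>e\<in>in_arcs G v. R e) = D v)"
    by (intro ballI infinite_disjoint_partition D)
  then obtain R where R': "\<forall>v\<in>verts G. (\<forall>e\<in>in_arcs G v. infinite (R v e)) \<and>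
      disjoint_family_on (R v) (in_arcs G v) \<and> (in_arcs G v \<noteq> {} \<longrightarrow> (\<Union>e\<in>in_arcs G v. R v e) = D v)"
    by (rule bchoice[THEN exE])
  have R: "infinite (R v e)" if "v \<in> verts G" "e \<in> in_arcs G v" for v e using R' that by simp
  have R_disj: "disjoint_family_on (R v) (in_arcs G v)" if "v \<in> verts G" for v using R' that by simp
  have R_un: "(\<Union>e\<in>in_arcs G v. R v e) = D v" if "v \<in> verts G" "in_arcs G v \<noteq> {}" for v
    using R' that by simp
  have "\<exists>T\<in>adjointable_ops. op_adjoint T o\<^sub>L T = coord_projection (D (tail G e)) \<and>
      T o\<^sub>L op_adjoint T = coord_projection (R (head G e) e)" if "e \<in> arcs G" for e
    using wf that by (intro partial_isometry_op_exists R D) (auto simp: wf_digraph_def)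
  then obtain T where T: "\<And>e. e \<in> arcs G \<Longrightarrow> T e \<in> adjointable_ops"
    and TT: "\<And>e. e \<in> arcs G \<Longrightarrow> op_adjoint (T e) o\<^sub>L T e = coord_projection (D (tail G e))"
      "\<And>e. e \<in> arcs G \<Longrightarrow> T e o\<^sub>L op_adjoint (T e) = coord_projection (R (head G e) e)"
    by metis
  have sum: "(\<Oplus>\<^bsub>op_algebra\<^esub>e\<in>F. T e \<otimes>\<^bsub>op_algebra\<^esub> adj op_algebra (T e)) = coord_projection (\<Union>e\<in>F. R v e)"
    if v: "v \<in> verts G" and F: "finite F" "F \<subseteq> in_arcs G v" for v F
  proof -
    have in_F: "e \<in> arcs G" "head G e = v" if "e \<in> F" for e using F that by auto
    have "(\<Oplus>\<^bsub>op_algebra\<^esub>e\<in>F. T e \<otimes>\<^bsub>op_algebra\<^esub> adj op_algebra (T e)) = (\<Sum>e\<in>F. T e o\<^sub>L op_adjoint (T e))"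
      using F by (simp add: op_algebra_finsum adjointable_ops_closed T in_F)
    also have "\<dots> = (\<Sum>e\<in>F. coord_projection (R v e))"
      by (rule sum.cong) (auto simp: TT in_F)
    also have "\<dots> = coord_projection (\<Union>e\<in>F. R v e)"
      using R_disj[OF v] F by (intro coord_projection_UN) (auto simp: disjoint_family_on_def)
    finally show ?thesis .
  qed
  have "ck_family G op_algebra (\<lambda>v. coord_projection (D v)) T"
    unfolding ck_family_def
  proof (intro conjI ballI allI impI)
    fix v assume v: "v \<in> verts G"
    show "projection op_algebra (coord_projection (D v))"
      by (simp add: projection_def coord_projection_adjointable adjoint_coord_projection coord_projection_compose)
    show "coord_projection (D v) \<otimes>\<^bsub>op_algebra\<^esub> coord_projection (D w) = \<zero>\<^bsub>op_algebra\<^esub>"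
      if "w \<in> verts G" "v \<noteq> w" for w
      using D_disj v that by (simp add: coord_projection_compose disjoint_family_on_def coord_projection_empty)
    show "cstar_le op_algebra (\<Oplus>\<^bsub>op_algebra\<^esub>e\<in>F. T e \<otimes>\<^bsub>op_algebra\<^esub> adj op_algebra (T e)) (coord_projection (D v))"
      if F: "finite F \<and> F \<subseteq> in_arcs G v" for F
    proof -
      have "(\<Union>e\<in>F. R v e) \<subseteq> D v" using R_un[OF v] F by blast
      then show ?thesis using F v by (simp only: sum coord_projection_le)
    qed
    show "(\<Oplus>\<^bsub>op_algebra\<^esub>e\<in>in_arcs G v. T e \<otimes>\<^bsub>op_algebra\<^esub> adj op_algebra (T e)) = coord_projection (D v)"
      if "in_arcs G v \<noteq> {} \<and> finite (in_arcs G v)"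
      using sum[OF v, of "in_arcs G v"] R_un[OF v] that by simp
  next
    fix e assume e: "e \<in> arcs G"
    have "T e o\<^sub>L op_adjoint (T e) o\<^sub>L T e = T e"
    proof -
      \<comment> \<open>A map T with T*T a projection P satisfies TP = T, since (T - TP)*(T - TP) = 0.\<close>
      let ?P = "coord_projection (D (tail G e))"
      have "norm (T e (x - ?P x)) = 0" for x
      proof -
        have "(norm (T e (x - ?P x)))\<^sup>2 = inner ((op_adjoint (T e) o\<^sub>L T e) (x - ?P x)) (x - ?P x)"
          using is_adjoint_op_adjoint[OF T[OF e]]
          by (simp add: is_adjoint_def power2_norm_eq_inner inner_commute)
        also have "(op_adjoint (T e) o\<^sub>L T e) (x - ?P x) = 0"
          unfolding TT(1)[OF e] by (rule ell2_eqI) (simp add: coord_coord_projection)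
        finally show ?thesis by simp
      qed
      then have "T e o\<^sub>L ?P = T e"
        by (intro blinfun_eqI) (simp add: blinfun.diff_right)
      moreover have "T e o\<^sub>L op_adjoint (T e) o\<^sub>L T e = T e o\<^sub>L (op_adjoint (T e) o\<^sub>L T e)"
        by (rule blinfun_eqI) simp
      ultimately show ?thesis by (simp only: TT(1)[OF e])
    qed
    then show "partial_isometry op_algebra (T e)"
      by (simp add: partial_isometry_def T[OF e])
    show "adj op_algebra (T e) \<otimes>\<^bsub>op_algebra\<^esub> T e = coord_projection (D (tail G e))"
      by (simp add: TT(1)[OF e])
  qed
  moreover have "\<forall>v\<in>verts G. D v \<noteq> {}" using D' finite.emptyI by metis
  ultimately show ?thesis by blast
qed

text \<open>
  The signs cancel in \<open>T e* T e\<close> and \<open>T e T e*\<close>, and the equation that makes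
  \<open>T e\<close> a partial isometry is odd in \<open>T e\<close>.
\<close>

lemma ck_family_negate:
  assumes ck: "ck_family G op_algebra Q T"
  shows "ck_family G op_algebra Q (\<lambda>e. - T e)"
proof -
  have T: "T e \<in> adjointable_ops" if "e \<in> arcs G" for e
    using ck that by (simp add: ck_family_def partial_isometry_def)
  have adj: "op_adjoint (- T e) = - op_adjoint (T e)" if "e \<in> arcs G" for e
    by (rule adjoint_eqI[OF is_adjoint_minus[OF is_adjoint_op_adjoint[OF T[OF that]]]])
  have minus: "(- U) o\<^sub>L V = - (U o\<^sub>L V)" "U o\<^sub>L (- V) = - (U o\<^sub>L V)" for U V :: "ell2 \<Rightarrow>\<^sub>L ell2"
    by (auto intro!: blinfun_eqI simp: blinfun.minus_left blinfun.minus_right)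
  have sum: "(\<Oplus>\<^bsub>op_algebra\<^esub>e\<in>F. (- T e) \<otimes>\<^bsub>op_algebra\<^esub> adj op_algebra (- T e))
      = (\<Oplus>\<^bsub>op_algebra\<^esub>e\<in>F. T e \<otimes>\<^bsub>op_algebra\<^esub> adj op_algebra (T e))"
    if "finite F" "F \<subseteq> in_arcs G v" for F v
  proof -
    have "e \<in> arcs G" if "e \<in> F" for e using \<open>F \<subseteq> in_arcs G v\<close> that by auto
    then show ?thesis using that(1)
      by (simp add: op_algebra_finsum adjointable_ops_closed T adj minus cong: sum.cong)
  qed
  have orthogonal: "\<forall>v\<in>verts G. \<forall>w\<in>verts G. v \<noteq> w \<longrightarrow> Q v \<otimes>\<^bsub>op_algebra\<^esub> Q w = \<zero>\<^bsub>op_algebra\<^esub>"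
    and tck: "\<forall>v\<in>verts G. \<forall>F. finite F \<and> F \<subseteq> in_arcs G v \<longrightarrow>
      cstar_le op_algebra (\<Oplus>\<^bsub>op_algebra\<^esub>e\<in>F. T e \<otimes>\<^bsub>op_algebra\<^esub> adj op_algebra (T e)) (Q v)"
    and cuntz_krieger: "\<forall>v\<in>verts G. in_arcs G v \<noteq> {} \<and> finite (in_arcs G v) \<longrightarrow>
      (\<Oplus>\<^bsub>op_algebra\<^esub>e\<in>in_arcs G v. T e \<otimes>\<^bsub>op_algebra\<^esub> adj op_algebra (T e)) = Q v"
    using ck unfolding ck_family_def by - (elim conjE, assumption)+
  show ?thesis
    unfolding ck_family_def
  proof (intro conjI ballI allI impI)
    fix v assume v: "v \<in> verts G"
    show "projection op_algebra (Q v)" using ck v by (simp add: ck_family_def)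
    show "Q v \<otimes>\<^bsub>op_algebra\<^esub> Q w = \<zero>\<^bsub>op_algebra\<^esub>" if "w \<in> verts G" "v \<noteq> w" for w
      using orthogonal v that by simp
    show "cstar_le op_algebra (\<Oplus>\<^bsub>op_algebra\<^esub>e\<in>F. (- T e) \<otimes>\<^bsub>op_algebra\<^esub> adj op_algebra (- T e)) (Q v)"
      if F: "finite F \<and> F \<subseteq> in_arcs G v" for F
      unfolding sum[OF conjunct1[OF F] conjunct2[OF F]] by (rule tck[rule_format, OF v F])
    show "(\<Oplus>\<^bsub>op_algebra\<^esub>e\<in>in_arcs G v. (- T e) \<otimes>\<^bsub>op_algebra\<^esub> adj op_algebra (- T e)) = Q v"
      if F: "in_arcs G v \<noteq> {} \<and> finite (in_arcs G v)"
      unfolding sum[OF conjunct2[OF F] subset_refl] by (rule cuntz_krieger[rule_format, OF v F])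
  next
    fix e assume e: "e \<in> arcs G"
    show "partial_isometry op_algebra (- T e)"
      using ck e T[OF e] by (simp add: ck_family_def partial_isometry_def adj minus adjointable_ops_closed)
    show "adj op_algebra (- T e) \<otimes>\<^bsub>op_algebra\<^esub> (- T e) = Q (tail G e)"
      using ck e by (simp add: ck_family_def adj minus)
  qed
qed

section \<open>Generation and rigidity\<close>

text \<open>
  The functional is the vector state of the basis vector \<open>basis k\<close>. On \<open>b* b\<close> its
  real part is \<open>\<parallel>\<pi> b (basis k)\<parallel>\<^sup>2\<close>, and its imaginary part
  vanishes because multiplication by \<open>\<i>\<close> is skew-adjoint.
\<close>

lemma contractive_positive_coefficient:
  assumes A: "cstar_algebra A" and \<pi>: "\<pi> \<in> star_hom A op_algebra"
  shows "contractive_positive A (\<lambda>x. coord (\<pi> x (basis k)) k)"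
proof -
  interpret cstar_algebra A by (rule A)
  note hom = star_hom_op_algebra_simps[OF \<pi>]
  have "cmod (coord (\<pi> x (basis k)) k) \<le> nrm A x" if "x \<in> carrier A" for x
    using norm_coord_le[of "\<pi> x (basis k)" k] norm_blinfun[of "\<pi> x" "basis k"]
      star_hom_contractive[OF \<pi> that] by simp
  moreover have "coord (\<pi> x (basis k)) k \<in> \<real>\<^sub>\<ge>\<^sub>0" if x_pos: "cstar_positive A x" for x
  proof -
    obtain b where b: "b \<in> carrier A" "x = adj A b \<otimes>\<^bsub>A\<^esub> b"
      using x_pos by (auto simp: cstar_positive_def)
    let ?u = "\<pi> b (basis k)"
    have x: "inner (\<pi> x (basis k)) w = inner ?u (\<pi> b w)" for w
      using b star_hom_inner_adj[OF \<pi> b(1), of ?u w] by (simp add: hom adj_closed)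
    have "inner ?u (cscale \<i> ?u) = inner ?u (cscale (- \<i>) ?u)"
      using inner_cscale_left[of \<i> ?u ?u] by (simp add: inner_commute)
    moreover have "cscale (- \<i>) ?u = - cscale \<i> ?u" by (rule ell2_eqI) simp
    ultimately have "inner ?u (cscale \<i> ?u) = 0" by simp
    then have "Im (coord (\<pi> x (basis k)) k) = 0"
      using x[of "cscale \<i> (basis k)"] hom(1)[OF b(1)] by (simp add: inner_basis op_cscale)
    moreover have "0 \<le> Re (coord (\<pi> x (basis k)) k)"
      using x[of "basis k"] by (simp flip: inner_basis)
    ultimately show ?thesis by (simp add: complex_nonneg_Reals_iff)
  qed
  ultimately show ?thesis
    by (simp add: contractive_positive_def linear_functional_def hom blinfun.add_left)
qed

lemma contractive_positive_average:
  assumes \<phi>: "contractive_positive A \<phi>" and \<psi>: "contractive_positive A \<psi>"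
  shows "contractive_positive A (\<lambda>x. (\<phi> x + \<psi> x) / 2)"
proof -
  have "cmod ((\<phi> x + \<psi> x) / 2) \<le> nrm A x" if "x \<in> carrier A" for x
  proof -
    have "cmod (\<phi> x) \<le> nrm A x" "cmod (\<psi> x) \<le> nrm A x"
      using \<phi> \<psi> that by (auto simp: contractive_positive_def)
    then show ?thesis using norm_triangle_ineq[of "\<phi> x" "\<psi> x"] by (simp add: norm_divide)
  qed
  then show ?thesis
    using \<phi> \<psi> unfolding contractive_positive_def linear_functional_def
    by (auto simp: add_divide_distrib algebra_simps complex_nonneg_Reals_iff)
qed

lemma star_hom_kernel_closed:
  assumes A: "cstar_algebra A" and \<pi>: "\<pi> \<in> star_hom A op_algebra"
  shows "closedin (Metric_space.mtopology (carrier A) (cstar_dist A)) {x \<in> carrier A. \<pi> x = 0}"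
proof -
  interpret cstar_algebra A by (rule A)
  interpret Metric_space "carrier A" "cstar_dist A" by (rule Metric_space_cstar_dist)
  note hom = star_hom_op_algebra_simps[OF \<pi>]
  show ?thesis unfolding metric_closedin_iff_sequentially_closed
  proof (intro conjI allI impI)
    fix \<sigma> l assume \<sigma>: "range \<sigma> \<subseteq> {x \<in> carrier A. \<pi> x = 0} \<and> limitin mtopology \<sigma> l sequentially"
    then have l: "l \<in> carrier A" by (simp add: limit_metric_sequentially)
    have "norm (\<pi> l) \<le> 0 + e" if e: "0 < e" for e
    proof -
      obtain n where "cstar_dist A (\<sigma> n) l < e"
        using \<sigma> e unfolding limit_metric_sequentially by blast
      moreover have \<sigma>n: "\<sigma> n \<in> carrier A" "\<pi> (\<sigma> n) = 0" using \<sigma> by auto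
      ultimately have "nrm A (l \<ominus>\<^bsub>A\<^esub> \<sigma> n) < e"
        using commute[of l "\<sigma> n"] l by (simp add: cstar_dist_def)
      moreover have "\<pi> (l \<ominus>\<^bsub>A\<^esub> \<sigma> n) = \<pi> l"
        using l \<sigma>n by (simp add: a_minus_smult hom smult_in_carrier)
      ultimately show ?thesis
        using star_hom_contractive[OF \<pi>, of "l \<ominus>\<^bsub>A\<^esub> \<sigma> n"] l \<sigma>n by simp
    qed
    then have "norm (\<pi> l) \<le> 0" by (rule field_le_epsilon)
    then show "l \<in> {x \<in> carrier A. \<pi> x = 0}" using l by simp
  qed auto
qed

lemma star_hom_kernel_star_subalgebra:
  assumes A: "cstar_algebra A" and \<pi>: "\<pi> \<in> star_hom A op_algebra"
  shows "star_subalgebra A {x \<in> carrier A. \<pi> x = 0}"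
proof -
  interpret cstar_algebra A by (rule A)
  note hom = star_hom_op_algebra_simps[OF \<pi>]
  have "norm (\<pi> \<zero>\<^bsub>A\<^esub>) \<le> 0" using star_hom_contractive[OF \<pi>, of "\<zero>\<^bsub>A\<^esub>"] by (simp add: nrm_zero)
  then show ?thesis
    by (simp add: star_subalgebra_def hom mult_closed adj_closed smult_in_carrier
        adjoint_eqI[OF is_adjoint_zero] subset_iff)
qed

lemma star_subalgebra_finsum:
  assumes A: "abelian_group A" and B: "star_subalgebra A B"
    and "finite F" and "\<And>i. i \<in> F \<Longrightarrow> h i \<in> B"
  shows "finsum A h F \<in> B"
proof -
  interpret abelian_group A by (rule A)
  have "B \<subseteq> carrier A" using B by (simp add: star_subalgebra_def)
  with \<open>finite F\<close> \<open>\<And>i. i \<in> F \<Longrightarrow> h i \<in> B\<close> show ?thesis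
    by (induction F rule: finite_induct) (use B in \<open>auto simp: star_subalgebra_def subset_iff Pi_def\<close>)
qed

lemma op_family_induces_star_hom:
  assumes "is_ck_algebra G A P S" and "wf_digraph G" and "ck_family G op_algebra Q T"
  shows "\<exists>\<pi>\<in>star_hom A op_algebra. (\<forall>v\<in>verts G. \<pi> (P v) = Q v) \<and> (\<forall>e\<in>arcs G. \<pi> (S e) = T e)"
  by (rule ck_algebra_universal[OF assms(1,2) cstar_algebra_op_algebra _ assms(3), of matrix_entries])
    (simp add: inj_matrix_entries)

lemma ck_edges_generate:
  assumes A: "is_ck_algebra G A P S"
    and iso: "\<forall>v\<in>verts G. \<not> isolated G v"
    and emit: "\<forall>v\<in>verts G. infinite_receiver G v \<longrightarrow> emitter G v"
  shows "generates A (S ` arcs G)"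
proof -
  have csA: "cstar_algebra A" and ck: "ck_family G A P S"
    and gen: "generates A (P ` verts G \<union> S ` arcs G)"
    using A by (simp_all add: is_ck_algebra_def)
  interpret cstar_algebra A by (rule csA)
  have P_in: "P v \<in> B" if B: "star_subalgebra A B" and SB: "S ` arcs G \<subseteq> B" and v: "v \<in> verts G" for B v
  proof (cases "out_arcs G v = {}")
    case False
    then obtain e where "e \<in> out_arcs G v" by blast
    then have e: "e \<in> arcs G" "tail G e = v" by simp_all
    then have "P v = adj A (S e) \<otimes>\<^bsub>A\<^esub> S e" using ck by (simp add: ck_family_def)
    then show ?thesis using B SB e by (auto simp: star_subalgebra_def)
  next
    case True
    then have fin: "finite (in_arcs G v)" "in_arcs G v \<noteq> {}"
      using iso emit v by (auto simp: isolated_def infinite_receiver_def emitter_def)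
    then have "P v = (\<Oplus>\<^bsub>A\<^esub>e\<in>in_arcs G v. S e \<otimes>\<^bsub>A\<^esub> adj A (S e))"
      using ck v by (simp add: ck_family_def)
    also have "\<dots> \<in> B"
    proof (rule star_subalgebra_finsum[OF M.abelian_group_axioms B fin(1)])
      show "S e \<otimes>\<^bsub>A\<^esub> adj A (S e) \<in> B" if "e \<in> in_arcs G v" for e
        using B SB that by (auto simp: star_subalgebra_def)
    qed
    finally show ?thesis .
  qed
  show ?thesis
    using gen P_in unfolding generates_def by blast
qed

text \<open>
  The zero operators and the identity in the place of \<open>P v\<close> form a Cuntz--Krieger family:
  the absence of emitted edges keeps the relation for \<open>S e* S e\<close> away from \<open>v\<close>, and
  the hypothesis on received edges keeps the summation relation away from it.
\<close>

lemma ck_edges_not_generate: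
  assumes wf: "wf_digraph G" and A: "is_ck_algebra G A P S" and v: "v \<in> verts G"
    and out: "out_arcs G v = {}" and receives: "in_arcs G v = {} \<or> infinite (in_arcs G v)"
  shows "\<not> generates A (S ` arcs G)"
proof
  assume gen: "generates A (S ` arcs G)"
  have csA: "cstar_algebra A" and ck: "ck_family G A P S" using A by (simp_all add: is_ck_algebra_def)
  define Q where "Q w = coord_projection (if w = v then UNIV else {})" for w
  have adj0: "op_adjoint 0 = 0" by (rule adjoint_eqI[OF is_adjoint_zero])
  have sum0: "(\<Oplus>\<^bsub>op_algebra\<^esub>e\<in>F. 0 \<otimes>\<^bsub>op_algebra\<^esub> adj op_algebra 0) = 0" if "finite F" for F :: "'b set"
    using that by (simp add: op_algebra_finsum zero_adjointable adj0)
  have "ck_family G op_algebra Q (\<lambda>_. 0)"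
    unfolding ck_family_def
  proof (intro conjI ballI allI impI)
    fix w assume w: "w \<in> verts G"
    show "projection op_algebra (Q w)"
      by (simp add: projection_def Q_def coord_projection_adjointable adjoint_coord_projection coord_projection_compose)
    show "Q w \<otimes>\<^bsub>op_algebra\<^esub> Q x = \<zero>\<^bsub>op_algebra\<^esub>" if "w \<noteq> x" for x
      using that by (auto simp: Q_def coord_projection_compose coord_projection_empty)
    show "cstar_le op_algebra (\<Oplus>\<^bsub>op_algebra\<^esub>e\<in>F. 0 \<otimes>\<^bsub>op_algebra\<^esub> adj op_algebra 0) (Q w)"
      if "finite F \<and> F \<subseteq> in_arcs G w" for F
      using coord_projection_le[of "{}"] that by (simp only: sum0 Q_def coord_projection_empty empty_subsetI)
    show "(\<Oplus>\<^bsub>op_algebra\<^esub>e\<in>in_arcs G w. 0 \<otimes>\<^bsub>op_algebra\<^esub> adj op_algebra 0) = Q w"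
      if in_w: "in_arcs G w \<noteq> {} \<and> finite (in_arcs G w)"
    proof -
      have "w \<noteq> v" using in_w receives by auto
      then show ?thesis using in_w by (simp only: sum0 Q_def coord_projection_empty if_False)
    qed
  next
    fix e assume e: "e \<in> arcs G"
    show "partial_isometry op_algebra 0"
      by (simp add: partial_isometry_def zero_adjointable)
    have "tail G e \<noteq> v" using out e by auto
    then show "adj op_algebra 0 \<otimes>\<^bsub>op_algebra\<^esub> 0 = Q (tail G e)"
      by (simp add: Q_def coord_projection_empty)
  qed
  then obtain \<pi> where \<pi>: "\<pi> \<in> star_hom A op_algebra"
    and \<pi>P: "\<forall>w\<in>verts G. \<pi> (P w) = Q w" and \<pi>S: "\<forall>e\<in>arcs G. \<pi> (S e) = 0"
    using op_family_induces_star_hom[OF A wf] by blast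
  have "S ` arcs G \<subseteq> {x \<in> carrier A. \<pi> x = 0}"
    using gen \<pi>S by (auto simp: generates_def)
  then have "{x \<in> carrier A. \<pi> x = 0} = carrier A"
    using gen star_hom_kernel_star_subalgebra[OF csA \<pi>] star_hom_kernel_closed[OF csA \<pi>]
    unfolding generates_def by blast
  moreover have "P v \<in> carrier A" using ck v by (simp add: ck_family_def projection_def)
  ultimately have "\<pi> (P v) = 0" by blast
  then have "coord_projection UNIV = 0" using \<pi>P v by (simp add: Q_def)
  then have "coord (coord_projection UNIV (basis 0)) 0 = 0" by simp
  then show False by (simp add: coord_coord_projection)
qed

text \<open>
  The average of a vector state over the two signs of the edges is constantly \<open>0\<close> on the
  edges, yet it is \<open>1\<close> on a vertex projection.
\<close>

lemma ck_edges_not_rigid: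
  assumes wf: "wf_digraph G" and V: "countable (verts G)" and E: "countable (arcs G)"
    and ne: "verts G \<noteq> {}" and A: "is_ck_algebra G A P S"
  shows "\<not> rigid_at_zero A (S ` arcs G)"
proof
  assume rigid: "rigid_at_zero A (S ` arcs G)"
  have csA: "cstar_algebra A" and ck: "ck_family G A P S" using A by (simp_all add: is_ck_algebra_def)
  obtain D T where D: "\<forall>v\<in>verts G. D v \<noteq> {}"
    and T: "ck_family G op_algebra (\<lambda>v. coord_projection (D v)) T"
    using ck_family_op_algebra_exists[OF wf V E] by blast
  obtain \<pi> where \<pi>: "\<pi> \<in> star_hom A op_algebra"
    and \<pi>P: "\<forall>v\<in>verts G. \<pi> (P v) = coord_projection (D v)" and \<pi>S: "\<forall>e\<in>arcs G. \<pi> (S e) = T e"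
    using op_family_induces_star_hom[OF A wf T] by blast
  obtain \<rho> where \<rho>: "\<rho> \<in> star_hom A op_algebra"
    and \<rho>P: "\<forall>v\<in>verts G. \<rho> (P v) = coord_projection (D v)" and \<rho>S: "\<forall>e\<in>arcs G. \<rho> (S e) = - T e"
    using op_family_induces_star_hom[OF A wf ck_family_negate[OF T]] by blast
  obtain v where v: "v \<in> verts G" using ne by blast
  then obtain k where k: "k \<in> D v" using D by blast
  define \<phi> where "\<phi> x = (coord (\<pi> x (basis k)) k + coord (\<rho> x (basis k)) k) / 2" for x
  have "contractive_positive A \<phi>"
    unfolding \<phi>_def by (intro contractive_positive_average contractive_positive_coefficient csA \<pi> \<rho>)
  moreover have "\<phi> (S e) = 0" if "e \<in> arcs G" for e
    using \<pi>S \<rho>S that by (simp add: \<phi>_def blinfun.minus_left)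
  ultimately have "(\<lambda>_::nat. \<phi> x) \<longlonglongrightarrow> 0" if "x \<in> carrier A" for x
    using rigid[unfolded rigid_at_zero_def, rule_format, of "\<lambda>_. \<phi>"] that by auto
  moreover have "P v \<in> carrier A" using ck v by (simp add: ck_family_def projection_def)
  ultimately have "\<phi> (P v) = 0" by (simp add: LIMSEQ_const_iff)
  moreover have "\<phi> (P v) = 1"
    using \<pi>P \<rho>P v k by (simp add: \<phi>_def coord_coord_projection)
  ultimately show False by simp
qed

theorem corollary5p4:
  fixes G :: "('v, 'e) pre_digraph"
    and A :: "'a cstar_alg"
    and P :: "'v \<Rightarrow> 'a"
    and S :: "'e \<Rightarrow> 'a"
  assumes "wf_digraph G" and "countable (verts G)" and "countable (arcs G)"
    and "verts G \<noteq> {}"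
    and "is_ck_algebra G A P S"
  shows "((\<forall>v\<in>verts G. \<not> isolated G v) \<and> (\<forall>v\<in>verts G. infinite_receiver G v \<longrightarrow> emitter G v)
            \<longleftrightarrow> generates A (S ` arcs G)) \<and>
         ((\<forall>v\<in>verts G. \<not> isolated G v) \<and> (\<forall>v\<in>verts G. infinite_receiver G v \<longrightarrow> emitter G v)
            \<longrightarrow> \<not> rigid_at_zero A (S ` arcs G))"
proof (intro conjI iffI impI)
  show "generates A (S ` arcs G)"
    if "(\<forall>v\<in>verts G. \<not> isolated G v) \<and> (\<forall>v\<in>verts G. infinite_receiver G v \<longrightarrow> emitter G v)"
    using ck_edges_generate[OF assms(5)] that by blast
  show "\<not> rigid_at_zero A (S ` arcs G)" by (rule ck_edges_not_rigid[OF assms])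
next
  assume gen: "generates A (S ` arcs G)"
  show "\<forall>v\<in>verts G. \<not> isolated G v"
    using ck_edges_not_generate[OF assms(1,5)] gen by (auto simp: isolated_def)
  show "\<forall>v\<in>verts G. infinite_receiver G v \<longrightarrow> emitter G v"
    using ck_edges_not_generate[OF assms(1,5)] gen by (auto simp: infinite_receiver_def emitter_def)
qed

end
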